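(* Let $C\geq1$ be a real number and let $\mathcal{F}$ be a weak finite degenerate family of graphs with $\beta'(\mathcal{F})\geq 2$ and $\operatorname{ex}(n,\mathcal{F})\leq Cn$. Let $G$ be an $\mathcal{F}$-free graph of order $n$, and let $\mathbf{x}$ be a non-negative eigenvector of the adjacency matrix $A(G)$ corresponding to $\lambda(G)$, with maximum entry equal to $1$. Then for every sufficiently small $\varepsilon$ with $0<\varepsilon<\big(\frac{1}{32C\beta'(\mathcal{F})}\big)^{40}$ and all sufficiently large $n$, the following hold: (1) if $\lambda(G)\geq\sqrt{(\beta'(\mathcal{F})-1)(n+1-\beta'(\mathcal{F}))}-\sqrt{\varepsilon n}$, then there exists $t>(1-2\beta'(\mathcal{F})\varepsilon^{1/10})n$ such that $K_{\beta'(\mathcal{F})-1,t}\subseteq G$; (2) moreover, letting $L'$ be the colour class of this $K_{\beta'(\mathcal{F})-1,t}$ of size $\beta'(\mathcal{F})-1$, we have $x_v\geq1-\varepsilon^{1/10}$ for every $v\in L'$ and $x_v\leq\varepsilon^{1/8}$ for every $v\notin L'$.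
   Context: A graph is $\mathcal{F}$-free if it contains no member of $\mathcal{F}$ as a subgraph; $\operatorname{ex}(n,\mathcal{F})$ is the maximum number of edges of an $\mathcal{F}$-free $n$-vertex graph. $\lambda(G)$ is the largest eigenvalue of $A(G)$. A covering of a graph is a vertex set meeting all its edges; $\beta'(G)$ is the minimum size of an independent covering ($+\infty$ if $G$ is not bipartite) and $\beta'(\mathcal{F})=\min_{F\in\mathcal{F}}\beta'(F)$. $\mathcal{F}$ is weak finite degenerate if there is a bipartite graph $F\in\mathcal{F}$ with $\beta'(F)=\beta'(\mathcal{F})$ whose order $|F|$ is bounded by a fixed constant (independent of $n$). *)

theory Defs
  imports "Jordan_Normal_Form.Spectral_Radius" "HOL-Library.Extended_Nat"
begin

record 'a ugraph =
  verts :: "'a set"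
  edges :: "'a set set"

definition simple_graph :: "'a ugraph \<Rightarrow> bool" where
  "simple_graph G \<longleftrightarrow> finite (verts G) \<and> (\<forall>e\<in>edges G. e \<subseteq> verts G \<and> card e = 2)"

definition subgraph :: "'a ugraph \<Rightarrow> 'a ugraph \<Rightarrow> bool" where
  "subgraph H G \<longleftrightarrow> verts H \<subseteq> verts G \<and> edges H \<subseteq> edges G"

definition graph_iso :: "'a ugraph \<Rightarrow> 'b ugraph \<Rightarrow> bool" where
  "graph_iso F H \<longleftrightarrow> (\<exists>f. bij_betw f (verts F) (verts H) \<and> (\<lambda>e. f ` e) ` edges F = edges H)"

definition contains :: "'a ugraph \<Rightarrow> 'b ugraph \<Rightarrow> bool" where
  "contains G F \<longleftrightarrow> (\<exists>H. simple_graph H \<and> subgraph H G \<and> graph_iso F H)"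

definition family_free :: "'b ugraph set \<Rightarrow> 'a ugraph \<Rightarrow> bool" where
  "family_free \<F> G \<longleftrightarrow> (\<forall>F\<in>\<F>. \<not> contains G F)"

text \<open>The maximum below ranges over a nonempty set as soon as every member of the family has
  an edge, because then edgeless graphs are free of the family.\<close>

definition ex_num :: "nat \<Rightarrow> 'b ugraph set \<Rightarrow> nat" where
  "ex_num n \<F> = Max {card (edges G) | G :: nat ugraph.
                     simple_graph G \<and> card (verts G) = n \<and> family_free \<F> G}"

definition complete_bipartite :: "'a set \<Rightarrow> 'a set \<Rightarrow> 'a ugraph" where
  "complete_bipartite L R = \<lparr>verts = L \<union> R, edges = {{u, v} | u v. u \<in> L \<and> v \<in> R}\<rparr>"

definition independent_set :: "'a ugraph \<Rightarrow> 'a set \<Rightarrow> bool" where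
  "independent_set G S \<longleftrightarrow> S \<subseteq> verts G \<and> (\<forall>e\<in>edges G. \<not> e \<subseteq> S)"

definition covering :: "'a ugraph \<Rightarrow> 'a set \<Rightarrow> bool" where
  "covering G S \<longleftrightarrow> S \<subseteq> verts G \<and> (\<forall>e\<in>edges G. e \<inter> S \<noteq> {})"

definition bipartite :: "'a ugraph \<Rightarrow> bool" where
  "bipartite G \<longleftrightarrow>
     (\<exists>A B. A \<union> B = verts G \<and> A \<inter> B = {} \<and> independent_set G A \<and> independent_set G B)"

text \<open>The infimum of the empty set of extended naturals is \<open>\<infinity>\<close>; the lemma below shows that this
  value is taken exactly for the non-bipartite graphs.\<close>

definition indep_cover_num :: "'a ugraph \<Rightarrow> enat" where
  "indep_cover_num G = (INF S\<in>{S. independent_set G S \<and> covering G S}. enat (card S))"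

lemma indep_cover_num_eq_infinity_iff:
  assumes "simple_graph G"
  shows "indep_cover_num G = \<infinity> \<longleftrightarrow> \<not> bipartite G"
proof -
  have "bipartite G \<longleftrightarrow> (\<exists>S. independent_set G S \<and> covering G S)"
  proof
    assume "bipartite G"
    then obtain A B where AB: "A \<union> B = verts G" "independent_set G A" "independent_set G B"
      unfolding bipartite_def by blast
    have "covering G A" unfolding covering_def
    proof (intro conjI ballI)
      show "A \<subseteq> verts G" using AB by blast
      fix e assume e: "e \<in> edges G"
      then have "e \<subseteq> A \<union> B" "\<not> e \<subseteq> B"
        using assms AB unfolding simple_graph_def independent_set_def by auto
      then show "e \<inter> A \<noteq> {}" by blast
    qed
    then show "\<exists>S. independent_set G S \<and> covering G S" using AB by blast
  next
    assume "\<exists>S. independent_set G S \<and> covering G S"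
    then obtain S where S: "independent_set G S" "covering G S" by blast
    then have "independent_set G (verts G - S)"
      unfolding independent_set_def covering_def by blast
    then show "bipartite G" using S unfolding bipartite_def
      by (intro exI[of _ S] exI[of _ "verts G - S"]) (auto simp: covering_def)
  qed
  moreover have "indep_cover_num G = \<infinity> \<longleftrightarrow> \<not> (\<exists>S. independent_set G S \<and> covering G S)"
  proof
    assume "indep_cover_num G = \<infinity>"
    moreover have "indep_cover_num G \<le> enat (card S)" if "independent_set G S" "covering G S" for S
      unfolding indep_cover_num_def using that by (intro INF_lower) auto
    ultimately show "\<not> (\<exists>S. independent_set G S \<and> covering G S)" by fastforce
  next
    assume "\<not> (\<exists>S. independent_set G S \<and> covering G S)"
    then have "{S. independent_set G S \<and> covering G S} = {}" by blast
    then show "indep_cover_num G = \<infinity>"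
      unfolding indep_cover_num_def by (simp only: image_empty Inf_empty top_enat_def)
  qed
  ultimately show ?thesis by blast
qed

definition family_indep_cover_num :: "'a ugraph set \<Rightarrow> enat" where
  "family_indep_cover_num \<F> = (INF F\<in>\<F>. indep_cover_num F)"

text \<open>The family is allowed to depend on the order \<open>n\<close> of the host graph (a family not depending
  on \<open>n\<close> is a constant sequence); the bound on the order of the witness is uniform in \<open>n\<close>.\<close>

definition weak_finite_degenerate :: "(nat \<Rightarrow> 'a ugraph set) \<Rightarrow> bool" where
  "weak_finite_degenerate \<F> \<longleftrightarrow>
     (\<exists>M. \<forall>n. \<exists>F\<in>\<F> n. bipartite F \<and> indep_cover_num F = family_indep_cover_num (\<F> n)
                         \<and> card (verts F) \<le> M)"

text \<open>Used for graphs with vertex set \<open>{0..<n}\<close>, where \<open>n\<close> is the order.\<close>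

definition adjacency_matrix :: "nat ugraph \<Rightarrow> real mat" where
  "adjacency_matrix G = mat (card (verts G)) (card (verts G))
                 (\<lambda>(i, j). if {i, j} \<in> edges G then 1 else 0)"

definition spectral_index :: "nat ugraph \<Rightarrow> real" where
  "spectral_index G = Max (spectrum (adjacency_matrix G))"

end

theory Submission
  imports Defs "HOL-Analysis.Convex"
begin

text \<open>
  Write \<open>k = \<beta>' - 1\<close>. A graph free of the family has at most \<open>C n\<close> edges and, for a constant \<open>M\<close>,
  contains no \<open>K\<^bsub>k+1,M\<^esub>\<close>. Linear edge bounds are not available for subgraphs, since the
  family may vary with \<open>n\<close>. Instead, weight each vertex of degree less than \<open>c n\<close> by its degree: a
  Kovari-Sos-Turan count for this measure shows that the vertices of low degree span few walks
  of length 3, hence few closed walks of length 4, so their adjacency operator has norm at most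
  \<open>\<delta> \<surd>n\<close> with \<open>\<delta>\<close> small when \<open>c\<close> is small. Therefore the eigenvector is tiny off the bounded set
  \<open>B\<close> of vertices of high degree. All but boundedly many vertices have at most \<open>k\<close> neighbours
  in \<open>B\<close>, so expanding \<open>\<lambda>\<^sup>2 x\<^sub>v\<close> over walks of length 2 at a vertex with
  \<open>x\<^sub>v = 1\<close> yields a vertex with exactly \<open>k\<close> neighbours in \<open>B\<close>, all of entry close to 1.
  These \<open>k\<close> vertices form \<open>L'\<close>: the same expansion gives each of them degree close to \<open>n\<close>, and
  any further vertex has fewer than \<open>M\<close> neighbours among their common neighbours, hence a small entry.
\<close>

section \<open>Sparse graphs without K_{k+1,M}: weighted Kovari-Sos-Turan counts\<close>

locale sparse_graph =
  fixes V :: "'a set" and adj :: "'a \<Rightarrow> 'a \<Rightarrow> bool" and k M :: nat and D :: real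
  assumes finite_V: "finite V"
    and adj_sym: "adj u v \<Longrightarrow> adj v u"
    and adj_irrefl: "\<not> adj v v"
    and degree_sum: "(\<Sum>v\<in>V. real (card {u\<in>V. adj v u})) \<le> D * real (card V)"
    and few_common: "X \<subseteq> V \<Longrightarrow> card X = Suc k \<Longrightarrow> card {u\<in>V. \<forall>w\<in>X. adj w u} < M"
begin

definition nbhd :: "'a \<Rightarrow> 'a set" where
  "nbhd v = {u\<in>V. adj v u}"

definition deg :: "'a \<Rightarrow> real" where
  "deg v = real (card (nbhd v))"

definition common_nbhd :: "'a set \<Rightarrow> 'a set" where
  "common_nbhd X = {u\<in>V. \<forall>w\<in>X. adj w u}"

lemma finite_nbhd [simp]: "finite (nbhd v)"
  using finite_V by (simp add: nbhd_def)

lemma finite_common_nbhd [simp]: "finite (common_nbhd X)"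
  using finite_V by (simp add: common_nbhd_def)

lemma nbhd_subset: "nbhd v \<subseteq> V"
  by (auto simp: nbhd_def)

lemma deg_nonneg [simp]: "0 \<le> deg v"
  by (simp add: deg_def)

lemma sum_deg_le: "(\<Sum>v\<in>V. deg v) \<le> D * real (card V)"
  using degree_sum by (simp add: deg_def nbhd_def)

lemma sum_nbhd_swap:
  assumes "A \<subseteq> V" "B \<subseteq> V"
  shows "(\<Sum>v\<in>A. \<Sum>u\<in>nbhd v \<inter> B. f v u) = (\<Sum>u\<in>B. \<Sum>v\<in>nbhd u \<inter> A. f v u)"
proof -
  have fin: "finite A" "finite B" using assms finite_V finite_subset by blast+
  have "(\<Sum>v\<in>A. \<Sum>u\<in>nbhd v \<inter> B. f v u) = (\<Sum>v\<in>A. \<Sum>u | u \<in> B \<and> adj v u. f v u)"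
    using assms by (intro sum.cong refl) (auto simp: nbhd_def)
  also have "\<dots> = (\<Sum>u\<in>B. \<Sum>v | v \<in> A \<and> adj v u. f v u)"
    using fin by (rule sum.swap_restrict)
  also have "\<dots> = (\<Sum>u\<in>B. \<Sum>v\<in>nbhd u \<inter> A. f v u)"
    using assms adj_sym by (intro sum.cong refl) (auto simp: nbhd_def)
  finally show ?thesis .
qed

text \<open>Induction on \<open>j\<close>, the number of vertices by which \<open>X\<close> falls
  short of k+1. One factor \<open>s v\<close> is opened as a sum over neighbours \<open>a\<close>;
  after exchanging the sums, \<open>v\<close> ranges over the common neighbourhood of
  \<open>insert a X\<close>. Once \<open>X\<close> has k+1 elements, fewer than \<open>M\<close>
  vertices of weight at most \<open>h\<close> remain.\<close>

lemma weighted_common_nbhd_sum_le: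
  fixes w :: "'a \<Rightarrow> real" and W :: "'a set"
  defines "s \<equiv> \<lambda>v. \<Sum>a\<in>nbhd v \<inter> W. w a"
  assumes W: "W \<subseteq> V" and w: "\<And>v. v \<in> W \<Longrightarrow> 0 \<le> w v" "\<And>v. v \<in> W \<Longrightarrow> w v \<le> h"
    and N: "(\<Sum>v\<in>W. w v) \<le> N" and h: "0 \<le> h"
    and X: "X \<subseteq> W" "card X + j = Suc k"
  shows "(\<Sum>v\<in>common_nbhd X \<inter> W. w v * s v ^ j) \<le> (real M + real (Suc k) * real j) * h * N ^ j"
  using X
proof (induction j arbitrary: X)
  case 0
  have "card (common_nbhd X) < M"
    using few_common[of X] 0 W by (auto simp: common_nbhd_def)
  then have card: "card (common_nbhd X \<inter> W) \<le> M"
    using card_mono[of "common_nbhd X" "common_nbhd X \<inter> W"] by simp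
  have "(\<Sum>v\<in>common_nbhd X \<inter> W. w v) \<le> real (card (common_nbhd X \<inter> W)) * h"
    using w by (intro sum_bounded_above) auto
  also have "\<dots> \<le> real M * h"
    using card h by (intro mult_right_mono) auto
  finally show ?case by simp
next
  case (Suc j)
  have finW: "finite W" using W finite_V finite_subset by blast
  have finX: "finite X" using Suc.prems finW finite_subset by blast
  have N0: "0 \<le> N" using N sum_nonneg[of W w, OF w(1)] by linarith
  have s0: "0 \<le> s v" for v unfolding s_def using w by (intro sum_nonneg) auto
  have sN: "s v \<le> N" for v
    unfolding s_def using w finW by (intro order_trans[OF sum_mono2 N]) auto
  let ?g = "\<lambda>a. \<Sum>v\<in>common_nbhd (insert a X) \<inter> W. w v * s v ^ j"
  let ?c = "(real M + real (Suc k) * real j) * h * N ^ j"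
  have "(\<Sum>v\<in>common_nbhd X \<inter> W. w v * s v ^ Suc j)
      = (\<Sum>v\<in>common_nbhd X \<inter> W. \<Sum>a\<in>nbhd v \<inter> W. w a * (w v * s v ^ j))"
    by (simp add: s_def sum_distrib_left sum_distrib_right mult_ac)
  also have "\<dots> = (\<Sum>a\<in>W. \<Sum>v\<in>nbhd a \<inter> (common_nbhd X \<inter> W). w a * (w v * s v ^ j))"
    using W by (intro sum_nbhd_swap) auto
  also have "\<dots> = (\<Sum>a\<in>W. w a * ?g a)"
    using W by (auto simp: sum_distrib_left nbhd_def common_nbhd_def intro!: sum.cong)
  \<comment> \<open>If \<open>a\<close> already lies in \<open>X\<close>, then
    \<open>insert a X\<close> is no larger and the induction hypothesis does not apply. There are at
    most k+1 such \<open>a\<close>, each charged the trivial bound \<open>h * N ^ Suc j\<close>;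
    this is the source of the summand \<open>real (Suc k) * real j\<close>.\<close>
  also have "\<dots> \<le> (\<Sum>a\<in>W. w a * ?c + (if a \<in> X then h * N ^ Suc j else 0))"
  proof (intro sum_mono)
    fix a assume a: "a \<in> W"
    show "w a * ?g a \<le> w a * ?c + (if a \<in> X then h * N ^ Suc j else 0)"
    proof (cases "a \<in> X")
      case True
      have "?g a \<le> (\<Sum>v\<in>common_nbhd (insert a X) \<inter> W. w v * N ^ j)"
        using w sN s0 by (intro sum_mono mult_left_mono power_mono) auto
      also have "\<dots> \<le> (\<Sum>v\<in>W. w v * N ^ j)"
        using w N0 finW by (intro sum_mono2) auto
      also have "\<dots> \<le> N * N ^ j"
        using N N0 by (simp add: sum_distrib_right[symmetric] mult_right_mono)
      finally have "w a * ?g a \<le> h * N ^ Suc j"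
        using w[OF a] w s0 h by (auto intro!: mult_mono sum_nonneg)
      moreover have "0 \<le> w a * ?c" using w[OF a] h N0 by simp
      ultimately show ?thesis using True by simp
    next
      case False
      then have "?g a \<le> ?c" using Suc.prems a finX by (intro Suc.IH) auto
      then show ?thesis using False w[OF a] by (simp add: mult_left_mono)
    qed
  qed
  also have "\<dots> = (\<Sum>a\<in>W. w a) * ?c + real (card X) * (h * N ^ Suc j)"
    using Suc.prems finW by (simp add: sum.distrib sum_distrib_right sum.If_cases Int_absorb1)
  also have "\<dots> \<le> N * ?c + real (Suc k) * (h * N ^ Suc j)"
    using N h N0 Suc.prems by (intro add_mono mult_right_mono) auto
  also have "\<dots> = (real M + real (Suc k) * real (Suc j)) * h * N ^ Suc j"
    by (simp add: algebra_simps)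
  finally show ?case .
qed

text \<open>Let \<open>s v\<close> be the inner sum. Vertices with \<open>s v \<le> \<theta>\<close>
  account for at most \<open>\<theta> * N\<close>. Above the threshold
  \<open>s v \<le> s v ^ Suc k / \<theta> ^ k\<close>, and the moment of order k+1 is controlled by
  the preceding count started from the empty set.\<close>

lemma weighted_edge_sum_le:
  fixes w :: "'a \<Rightarrow> real"
  assumes W: "W \<subseteq> V" and w: "\<And>v. v \<in> W \<Longrightarrow> 0 \<le> w v" "\<And>v. v \<in> W \<Longrightarrow> w v \<le> h"
    and N: "(\<Sum>v\<in>W. w v) \<le> N" and h: "0 \<le> h" and \<theta>: "0 < \<theta>"
  shows "(\<Sum>v\<in>W. w v * (\<Sum>a\<in>nbhd v \<inter> W. w a))
    \<le> \<theta> * N + (real M + (real (Suc k))\<^sup>2) * h * N ^ Suc k / \<theta> ^ k"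
proof -
  define s where "s v = (\<Sum>a\<in>nbhd v \<inter> W. w a)" for v
  have s0: "0 \<le> s v" for v unfolding s_def using w by (intro sum_nonneg) auto
  have pt: "s v \<le> \<theta> + s v ^ Suc k / \<theta> ^ k" for v
  proof (cases "s v \<le> \<theta>")
    case True
    then show ?thesis using s0 \<theta> by (simp add: add_increasing2)
  next
    case False
    then have "s v * \<theta> ^ k \<le> s v ^ Suc k"
      using s0 \<theta> by (simp add: mult_left_mono power_mono)
    then show ?thesis using \<theta> by (simp add: add_increasing pos_le_divide_eq)
  qed
  have "(\<Sum>v\<in>W. w v * s v) \<le> (\<Sum>v\<in>W. w v * (\<theta> + s v ^ Suc k / \<theta> ^ k))"
    using w pt by (intro sum_mono mult_left_mono) auto
  also have "\<dots> = \<theta> * (\<Sum>v\<in>W. w v) + (\<Sum>v\<in>W. w v * s v ^ Suc k) / \<theta> ^ k"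
    by (simp only: distrib_left sum.distrib sum_distrib_left sum_divide_distrib times_divide_eq_right
        mult.commute[of \<theta>])
  also have "\<dots> \<le> \<theta> * N + (real M + real (Suc k) * real (Suc k)) * h * N ^ Suc k / \<theta> ^ k"
  proof (intro add_mono mult_left_mono divide_right_mono N)
    have "common_nbhd {} \<inter> W = W" using W by (auto simp: common_nbhd_def)
    then show "(\<Sum>v\<in>W. w v * s v ^ Suc k)
        \<le> (real M + real (Suc k) * real (Suc k)) * h * N ^ Suc k"
      using weighted_common_nbhd_sum_le[OF W w N h, of "{}" "Suc k"] by (simp only: s_def) simp
  qed (use \<theta> in auto)
  finally show ?thesis by (simp add: s_def power2_eq_square)
qed

section \<open>Splitting by degree, and vertices with many neighbours in a given set\<close>

definition low_deg :: "real \<Rightarrow> 'a set" where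
  "low_deg c = {v\<in>V. deg v < c * real (card V)}"

definition high_deg :: "real \<Rightarrow> 'a set" where
  "high_deg c = {v\<in>V. c * real (card V) \<le> deg v}"

lemma low_deg_subset: "low_deg c \<subseteq> V" and high_deg_subset: "high_deg c \<subseteq> V"
  by (auto simp: low_deg_def high_deg_def)

lemma card_high_deg_le:
  assumes "V \<noteq> {}" "0 < c"
  shows "real (card (high_deg c)) \<le> D / c"
proof -
  have n: "0 < real (card V)" using assms finite_V by (simp add: card_gt_0_iff)
  have "real (card (high_deg c)) * (c * real (card V)) \<le> (\<Sum>v\<in>high_deg c. deg v)"
    by (intro sum_bounded_below) (auto simp: high_deg_def)
  also have "\<dots> \<le> (\<Sum>v\<in>V. deg v)"
    using finite_V high_deg_subset by (intro sum_mono2) auto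
  also have "\<dots> \<le> D * real (card V)" by (rule sum_deg_le)
  finally show ?thesis using n assms by (simp add: pos_le_divide_eq flip: mult.assoc)
qed

definition crowded :: "'a set \<Rightarrow> 'a set" where
  "crowded B = {u\<in>V. k < card (nbhd u \<inter> B)}"

text \<open>A crowded vertex lies in the common neighbourhood of some (k+1)-subset of
  \<open>B\<close>, and there are at most \<open>2 ^ card B\<close> of those. The bound does not
  involve the order of the graph.\<close>

lemma card_crowded_le:
  assumes B: "B \<subseteq> V"
  shows "card (crowded B) \<le> M * 2 ^ card B"
proof -
  have finB: "finite B" using B finite_V finite_subset by blast
  let ?P = "{X. X \<subseteq> B \<and> card X = Suc k}"
  have P: "finite ?P" "card ?P \<le> 2 ^ card B"
    using finB card_mono[of "Pow B" ?P] by (auto simp: card_Pow)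
  have "crowded B \<subseteq> (\<Union>X\<in>?P. common_nbhd X)"
  proof
    fix u assume u: "u \<in> crowded B"
    then have "Suc k \<le> card (nbhd u \<inter> B)" by (simp add: crowded_def)
    then obtain X where X: "X \<subseteq> nbhd u \<inter> B" "card X = Suc k"
      by (rule obtain_subset_with_card_n)
    then have "X \<in> ?P" "u \<in> common_nbhd X"
      using u adj_sym by (auto simp: common_nbhd_def nbhd_def crowded_def)
    then show "u \<in> (\<Union>X\<in>?P. common_nbhd X)" by blast
  qed
  then have "card (crowded B) \<le> card (\<Union>X\<in>?P. common_nbhd X)"
    using P by (intro card_mono) auto
  also have "\<dots> \<le> (\<Sum>X\<in>?P. card (common_nbhd X))" using P by (intro card_UN_le)
  also have "\<dots> \<le> (\<Sum>X\<in>?P. M)"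
  proof (intro sum_mono)
    fix X assume "X \<in> ?P"
    then have "X \<subseteq> V" "card X = Suc k" using B by auto
    then show "card (common_nbhd X) \<le> M"
      using few_common[of X] by (simp add: common_nbhd_def)
  qed
  also have "\<dots> \<le> M * 2 ^ card B" using P by simp
  finally show ?thesis .
qed

text \<open>In the applications a sharp bound \<open>g\<close> is available only off
  \<open>crowded B\<close>; on the few crowded vertices a crude bound \<open>h\<close> is
  affordable, since the error depends only on \<open>h\<close>, \<open>M\<close> and
  \<open>card B\<close>.\<close>

lemma sum_not_crowded_le:
  fixes f :: "'a \<Rightarrow> real"
  assumes B: "B \<subseteq> V" and U: "U \<subseteq> V"
    and f: "\<And>u. u \<in> U - crowded B \<Longrightarrow> f u \<le> g u" "\<And>u. u \<in> U \<inter> crowded B \<Longrightarrow> f u \<le> h"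
    and gh: "0 \<le> h"
  shows "(\<Sum>u\<in>U. f u) \<le> (\<Sum>u\<in>U - crowded B. g u) + h * (real M * 2 ^ card B)"
proof -
  have finU: "finite U" using U finite_V finite_subset by blast
  have finC: "finite (crowded B)" using finite_V by (simp add: crowded_def)
  have "(\<Sum>u\<in>U \<inter> crowded B. f u) \<le> real (card (U \<inter> crowded B)) * h"
    using f by (intro sum_bounded_above) auto
  also have "\<dots> \<le> real (M * 2 ^ card B) * h"
    using gh card_crowded_le[OF B] card_mono[OF finC, of "U \<inter> crowded B"]
    by (intro mult_right_mono of_nat_mono) auto
  finally have "(\<Sum>u\<in>U \<inter> crowded B. f u) \<le> h * (real M * 2 ^ card B)" by (simp add: mult_ac)
  moreover have "(\<Sum>u\<in>U - crowded B. f u) \<le> (\<Sum>u\<in>U - crowded B. g u)"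
    using f by (intro sum_mono) auto
  moreover have "(\<Sum>u\<in>U. f u) = (\<Sum>u\<in>U \<inter> crowded B. f u) + (\<Sum>u\<in>U - crowded B. f u)"
    using finU by (rule sum.Int_Diff)
  ultimately show ?thesis by linarith
qed

section \<open>Closed walks of length 4 inside \<open>W\<close>; on \<open>W\<close>,
  \<open>codeg W\<close> is the squared adjacency matrix\<close>

definition codeg :: "'a set \<Rightarrow> 'a \<Rightarrow> 'a \<Rightarrow> real" where
  "codeg W u v = real (card (nbhd u \<inter> (nbhd v \<inter> W)))"

text \<open>The left side counts closed walks of length 4 inside \<open>W\<close>. Bounding one
  factor \<open>codeg W v u\<close> by \<open>deg v\<close> leaves walks from \<open>v\<close> over
  \<open>a\<close> to \<open>u\<close>, at most \<open>deg a\<close> for each \<open>a\<close>. The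
  result is an edge sum weighted by degrees, the form treated by
  \<open>weighted_edge_sum_le\<close>.\<close>

lemma sum_codeg_square_le:
  assumes W: "W \<subseteq> V"
  shows "(\<Sum>v\<in>W. \<Sum>u\<in>W. (codeg W v u)\<^sup>2) \<le> (\<Sum>v\<in>W. deg v * (\<Sum>a\<in>nbhd v \<inter> W. deg a))"
proof (rule sum_mono)
  fix v assume v: "v \<in> W"
  have "(\<Sum>u\<in>W. (codeg W v u)\<^sup>2) \<le> (\<Sum>u\<in>W. deg v * codeg W v u)"
    unfolding power2_eq_square
    by (intro sum_mono mult_right_mono) (auto simp: codeg_def deg_def intro!: card_mono)
  also have "\<dots> = deg v * (\<Sum>u\<in>W. \<Sum>a\<in>nbhd u \<inter> (nbhd v \<inter> W). 1)"
    by (simp add: sum_distrib_left codeg_def Int_ac)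
  also have "\<dots> = deg v * (\<Sum>a\<in>nbhd v \<inter> W. \<Sum>u\<in>nbhd a \<inter> W. 1)"
    using W by (subst sum_nbhd_swap) auto
  also have "\<dots> \<le> deg v * (\<Sum>a\<in>nbhd v \<inter> W. deg a)"
    by (intro mult_left_mono sum_mono) (auto simp: deg_def intro!: card_mono)
  finally show "(\<Sum>u\<in>W. (codeg W v u)\<^sup>2) \<le> deg v * (\<Sum>a\<in>nbhd v \<inter> W. deg a)" .
qed

lemma sum_two_walks:
  assumes W: "W \<subseteq> V"
  shows "(\<Sum>u\<in>nbhd v \<inter> W. \<Sum>w\<in>nbhd u \<inter> W. f w) = (\<Sum>w\<in>W. codeg W v w * f w)"
  using W by (subst sum_nbhd_swap) (auto simp: codeg_def Int_ac)

text \<open>Let A be the adjacency operator on \<open>W\<close>, z = A y and q = A z. Through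
  \<open>sum_codeg_square_le\<close> the hypothesis bounds the Frobenius norm of A^2 by
  \<open>F\<close>, so |q| <= F |y|. Symmetry of A gives |z|^2 = <y, q> <= F |y|^2, and a single
  coordinate of q is at most |q|.\<close>

lemma two_walk_bounds:
  fixes y :: "'a \<Rightarrow> real"
  assumes W: "W \<subseteq> V" and y: "\<And>v. v \<in> W \<Longrightarrow> 0 \<le> y v" and F: "0 \<le> F"
    and codeg: "(\<Sum>v\<in>W. deg v * (\<Sum>a\<in>nbhd v \<inter> W. deg a)) \<le> F\<^sup>2"
  defines "z \<equiv> \<lambda>v. \<Sum>u\<in>nbhd v \<inter> W. y u"
  shows "(\<Sum>v\<in>W. (z v)\<^sup>2) \<le> F * (\<Sum>v\<in>W. (y v)\<^sup>2)"
    and "v \<in> W \<Longrightarrow> (\<Sum>u\<in>nbhd v \<inter> W. z u) \<le> F * sqrt (\<Sum>v\<in>W. (y v)\<^sup>2)"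
proof -
  define Y where "Y = (\<Sum>v\<in>W. (y v)\<^sup>2)"
  define q where "q v = (\<Sum>u\<in>nbhd v \<inter> W. z u)" for v
  have Y0: "0 \<le> Y" unfolding Y_def by (intro sum_nonneg) auto
  have finW: "finite W" using W finite_V finite_subset by blast
  have q: "(q v)\<^sup>2 \<le> (\<Sum>w\<in>W. (codeg W v w)\<^sup>2) * Y" for v
    unfolding q_def z_def Y_def sum_two_walks[OF W] by (rule Cauchy_Schwarz_ineq_sum)
  have "(\<Sum>v\<in>W. (q v)\<^sup>2) \<le> (\<Sum>v\<in>W. \<Sum>w\<in>W. (codeg W v w)\<^sup>2) * Y"
    unfolding sum_distrib_right by (rule sum_mono) (use q in \<open>simp add: sum_distrib_right\<close>)
  also have "\<dots> \<le> F\<^sup>2 * Y"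
    using sum_codeg_square_le[OF W] codeg Y0 by (intro mult_right_mono) auto
  finally have qsum: "(\<Sum>v\<in>W. (q v)\<^sup>2) \<le> F\<^sup>2 * Y" .
  have "(\<Sum>v\<in>W. (z v)\<^sup>2) = (\<Sum>v\<in>W. \<Sum>u\<in>nbhd v \<inter> W. y u * z v)"
    by (simp add: power2_eq_square z_def sum_distrib_right)
  also have "\<dots> = (\<Sum>v\<in>W. y v * q v)"
    using W by (subst sum_nbhd_swap) (auto simp: q_def sum_distrib_left)
  finally have zq: "(\<Sum>v\<in>W. (z v)\<^sup>2) = (\<Sum>v\<in>W. y v * q v)" .
  have "(\<Sum>v\<in>W. y v * q v)\<^sup>2 \<le> Y * (\<Sum>v\<in>W. (q v)\<^sup>2)"
    unfolding Y_def by (rule Cauchy_Schwarz_ineq_sum)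
  also have "\<dots> \<le> Y * (F\<^sup>2 * Y)" using qsum Y0 by (rule mult_left_mono)
  also have "\<dots> = (F * Y)\<^sup>2" by (simp add: power2_eq_square)
  finally have "(\<Sum>v\<in>W. y v * q v) \<le> F * Y" by (rule power2_le_imp_le) (use F Y0 in simp)
  then show "(\<Sum>v\<in>W. (z v)\<^sup>2) \<le> F * (\<Sum>v\<in>W. (y v)\<^sup>2)" using zq by (simp add: Y_def)
  show "(\<Sum>u\<in>nbhd v \<inter> W. z u) \<le> F * sqrt (\<Sum>v\<in>W. (y v)\<^sup>2)" if v: "v \<in> W"
  proof -
    have "(q v)\<^sup>2 \<le> (\<Sum>v\<in>W. (q v)\<^sup>2)"
      using v finW by (intro member_le_sum) auto
    also have "\<dots> \<le> (F * sqrt Y)\<^sup>2" using qsum Y0 by (simp add: power_mult_distrib)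
    finally have "q v \<le> F * sqrt Y" by (rule power2_le_imp_le) (use F Y0 in simp)
    then show ?thesis by (simp add: q_def Y_def)
  qed
qed

end

section \<open>The eigenvector: entries at vertices of low degree are small\<close>

locale spectral_graph = sparse_graph +
  fixes x :: "'a \<Rightarrow> real" and \<rho> :: real
  assumes eigen: "v \<in> V \<Longrightarrow> \<rho> * x v = (\<Sum>u\<in>nbhd v. x u)"
    and x_nonneg: "v \<in> V \<Longrightarrow> 0 \<le> x v"
    and x_le_1: "v \<in> V \<Longrightarrow> x v \<le> 1"
    and x_max: "\<exists>v\<in>V. x v = 1"
    and k_pos: "1 \<le> k"
    and \<rho>_large: "real k * real (card V) / 2 \<le> \<rho>\<^sup>2"
begin

lemma card_V_pos: "0 < real (card V)"
  using x_max finite_V by (auto simp: card_gt_0_iff)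

lemma \<rho>_nonneg: "0 \<le> \<rho>"
proof -
  obtain v where "v \<in> V" "x v = 1" using x_max by blast
  then show ?thesis
    using eigen[of v] sum_nonneg[of "nbhd v" x] x_nonneg nbhd_subset by auto
qed

lemma \<rho>_square_ge: "real (card V) / 2 \<le> \<rho>\<^sup>2"
proof -
  have "1 * real (card V) \<le> real k * real (card V)" using k_pos by (intro mult_right_mono) auto
  then show ?thesis using \<rho>_large by linarith
qed

lemma eigen_square:
  assumes "v \<in> V"
  shows "\<rho>\<^sup>2 * x v = (\<Sum>u\<in>nbhd v. \<Sum>w\<in>nbhd u. x w)"
proof -
  have "\<rho>\<^sup>2 * x v = \<rho> * (\<rho> * x v)" by (simp add: power2_eq_square)
  also have "\<dots> = (\<Sum>u\<in>nbhd v. \<rho> * x u)" using eigen[OF assms] by (simp add: sum_distrib_left)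
  also have "\<dots> = (\<Sum>u\<in>nbhd v. \<Sum>w\<in>nbhd u. x w)"
    using eigen nbhd_subset by (intro sum.cong) auto
  finally show ?thesis .
qed

lemma sum_deg_nbhd_le: "(\<Sum>u\<in>nbhd v. deg u) \<le> D * real (card V)"
  using order_trans[OF sum_mono2 sum_deg_le] finite_V nbhd_subset by simp

text \<open>At a vertex of entry 1, \<open>\<rho>\<^sup>2\<close> is a sum of entries over walks of
  length 2, hence at most the total degree.\<close>

lemma \<rho>_square_le: "\<rho>\<^sup>2 \<le> D * real (card V)"
proof -
  obtain v where v: "v \<in> V" "x v = 1" using x_max by blast
  have "\<rho>\<^sup>2 = (\<Sum>u\<in>nbhd v. \<Sum>w\<in>nbhd u. x w)" using eigen_square[of v] v by simp
  also have "\<dots> \<le> (\<Sum>u\<in>nbhd v. deg u)"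
  proof (rule sum_mono)
    fix u
    show "(\<Sum>w\<in>nbhd u. x w) \<le> deg u"
      using sum_bounded_above[of "nbhd u" x 1] x_le_1 nbhd_subset[of u] by (auto simp: deg_def)
  qed
  also have "\<dots> \<le> D * real (card V)" by (rule sum_deg_nbhd_le)
  finally show ?thesis .
qed

text \<open>The contribution of \<open>B\<close> to the eigenvalue equation at
  \<open>u\<close>.\<close>

definition load :: "'a set \<Rightarrow> 'a \<Rightarrow> real" where
  "load B u = (\<Sum>w\<in>nbhd u \<inter> B. x w)"

lemma load_nonneg: "0 \<le> load B u"
  unfolding load_def using x_nonneg nbhd_subset by (intro sum_nonneg) auto

lemma load_le_card: "load B u \<le> real (card (nbhd u \<inter> B))"
  using sum_bounded_above[of "nbhd u \<inter> B" x 1] x_le_1 nbhd_subset[of u] by (auto simp: load_def)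

lemma load_le_card_set: "B \<subseteq> V \<Longrightarrow> load B u \<le> real (card B)"
  using load_le_card[of B u] card_mono[of B "nbhd u \<inter> B"] finite_V
  by (meson Int_lower2 finite_subset of_nat_mono order_trans)

lemma load_not_crowded: "u \<in> V - crowded B \<Longrightarrow> load B u \<le> real k"
  using load_le_card[of B u] by (auto simp: crowded_def)

text \<open>On the low-degree vertices, \<open>\<rho> * x u\<close> splits into a part
  \<open>z u\<close> from low degree and the load from high degree. Summed in squares, this bounds
  the Euclidean norm of \<open>x\<close> on the low-degree vertices by 4k; iterated at the single
  vertex \<open>v\<close>, it bounds \<open>x v\<close>. The terms with \<open>K\<close> are of
  lower order than \<open>n\<close>, since \<open>\<rho>\<close> grows at most like the square root
  of \<open>n\<close>.\<close>

lemma entry_low_deg_le: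
  fixes c \<omega> :: real and K :: nat
  defines "Q \<equiv> real M * 2 ^ K" and "n \<equiv> real (card V)"
  assumes \<omega>: "0 \<le> \<omega>" "\<omega> \<le> 1 / 8"
    and walks: "(\<Sum>v\<in>low_deg c. deg v * (\<Sum>a\<in>nbhd v \<inter> low_deg c. deg a)) \<le> (\<omega> * n)\<^sup>2"
    and K: "card (high_deg c) \<le> K" and n_large: "(real K)\<^sup>2 * Q \<le> n"
    and v: "v \<in> low_deg c"
  shows "n / 2 * x v \<le> 4 * real k * \<omega> * n + real k * c * n + real K * Q + real K * \<rho>"
proof -
  let ?W = "low_deg c" and ?B = "high_deg c"
  have W: "?W \<subseteq> V" and B: "?B \<subseteq> V" by (rule low_deg_subset high_deg_subset)+
  have n0: "0 < n" using card_V_pos by (simp add: n_def)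
  have split: "nbhd u = (nbhd u \<inter> ?W) \<union> (nbhd u \<inter> ?B)"
     "(nbhd u \<inter> ?W) \<inter> (nbhd u \<inter> ?B) = {}" for u
    using nbhd_subset by (auto simp: low_deg_def high_deg_def)
  have sum_split: "(\<Sum>w\<in>nbhd u. f w) = (\<Sum>w\<in>nbhd u \<inter> ?W. f w) + (\<Sum>w\<in>nbhd u \<inter> ?B. f w)"
    for f :: "'a \<Rightarrow> real" and u
    by (subst split(1)) (rule sum.union_disjoint, use split(2) in auto)
  define z where "z u = (\<Sum>w\<in>nbhd u \<inter> ?W. x w)" for u
  define Y where "Y = (\<Sum>v\<in>?W. (x v)\<^sup>2)"
  have Y0: "0 \<le> Y" unfolding Y_def by (intro sum_nonneg) auto
  have eig: "\<rho> * x u = z u + load ?B u" if "u \<in> V" for u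
    using eigen[OF that] sum_split[of x u] by (simp add: z_def load_def)
  have Fn: "0 \<le> \<omega> * n" using \<omega> n0 by simp
  have xW: "\<And>v. v \<in> ?W \<Longrightarrow> 0 \<le> x v" using x_nonneg W by auto
  note tw = two_walk_bounds[where W = ?W and y = x, OF W _ Fn walks, folded z_def Y_def]
  have tw1: "(\<Sum>u\<in>?W. (z u)\<^sup>2) \<le> \<omega> * n * Y" using tw(1) xW by blast
  have tw2: "(\<Sum>u\<in>nbhd v \<inter> ?W. z u) \<le> \<omega> * n * sqrt Y" using tw(2) xW v by blast
  have QK: "real M * 2 ^ card ?B \<le> Q"
    unfolding Q_def using K by (intro mult_left_mono power_increasing) auto
  have Q0: "0 \<le> Q" by (simp add: Q_def)
  have loadK: "load ?B u \<le> real K" for u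
    using load_le_card_set[OF B, of u] K by linarith

  have "(\<Sum>u\<in>?W. (load ?B u)\<^sup>2) \<le> (\<Sum>u\<in>?W - crowded ?B. (real k)\<^sup>2) + (real K)\<^sup>2 * (real M * 2 ^ card ?B)"
    using load_nonneg loadK load_not_crowded W
    by (intro sum_not_crowded_le[OF B W] power_mono) auto
  also have "\<dots> \<le> n * (real k)\<^sup>2 + (real K)\<^sup>2 * Q"
  proof (intro add_mono mult_left_mono QK)
    have "card (?W - crowded ?B) \<le> card V"
      using W finite_V by (intro card_mono) auto
    then show "(\<Sum>u\<in>?W - crowded ?B. (real k)\<^sup>2) \<le> n * (real k)\<^sup>2"
      by (simp add: n_def mult_right_mono)
  qed auto
  \<comment> \<open>By \<open>n_large\<close> the crowded vertices contribute at most
    \<open>n\<close>, hence no more than the main term.\<close>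
  also have "\<dots> \<le> n * (real k)\<^sup>2 + n * (real k)\<^sup>2"
  proof -
    have "n * 1 \<le> n * (real k)\<^sup>2" using n0 k_pos by (intro mult_left_mono one_le_power) auto
    then show ?thesis using n_large by simp
  qed
  finally have load2: "(\<Sum>u\<in>?W. (load ?B u)\<^sup>2) \<le> 2 * n * (real k)\<^sup>2" by simp

  have "\<rho>\<^sup>2 * Y = (\<Sum>u\<in>?W. (\<rho> * x u)\<^sup>2)"
    by (simp add: Y_def sum_distrib_left power_mult_distrib)
  also have "\<dots> \<le> (\<Sum>u\<in>?W. 2 * (z u)\<^sup>2 + 2 * (load ?B u)\<^sup>2)"
  proof (rule sum_mono)
    fix u assume "u \<in> ?W"
    then have "\<rho> * x u = z u + load ?B u" using eig W by auto
    then show "(\<rho> * x u)\<^sup>2 \<le> 2 * (z u)\<^sup>2 + 2 * (load ?B u)\<^sup>2"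
      using sum_squares_bound[of "z u" "load ?B u"] by (simp add: power2_sum)
  qed
  also have "\<dots> = 2 * (\<Sum>u\<in>?W. (z u)\<^sup>2) + 2 * (\<Sum>u\<in>?W. (load ?B u)\<^sup>2)"
    by (simp add: sum.distrib sum_distrib_left)
  also have "\<dots> \<le> 2 * (\<omega> * n * Y) + 4 * n * (real k)\<^sup>2"
    using tw1 load2 by simp
  \<comment> \<open>The bound 1/8 on \<open>\<omega>\<close> makes the coefficient of
    \<open>Y\<close> equal to n/4, below the n/2 that \<open>\<rho>\<^sup>2\<close> supplies on the
    left, so the term in \<open>Y\<close> is absorbed.\<close>
  also have "\<dots> \<le> n / 4 * Y + 4 * n * (real k)\<^sup>2"
    using mult_right_mono[OF \<omega>(2), of "n * Y"] n0 Y0 by simp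
  finally have "\<rho>\<^sup>2 * Y \<le> n / 4 * Y + 4 * n * (real k)\<^sup>2" .
  moreover have "n / 2 * Y \<le> \<rho>\<^sup>2 * Y"
    using \<rho>_square_ge Y0 by (intro mult_right_mono) (auto simp: n_def)
  ultimately have "n * Y \<le> n * (16 * (real k)\<^sup>2)" by simp
  then have "Y \<le> (4 * real k)\<^sup>2" using n0 by (simp add: power_mult_distrib)
  then have sqrtY: "sqrt Y \<le> 4 * real k" by (intro real_le_lsqrt) (use Y0 in auto)

  \<comment> \<open>Here the low degree of \<open>v\<close> itself enters: fewer than
    \<open>c * n\<close> neighbours, each of load at most k unless crowded.\<close>
  have "(\<Sum>u\<in>nbhd v \<inter> ?W. load ?B u)
      \<le> (\<Sum>u\<in>nbhd v \<inter> ?W - crowded ?B. real k) + real K * (real M * 2 ^ card ?B)"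
    using loadK load_not_crowded W by (intro sum_not_crowded_le[OF B]) auto
  also have "\<dots> \<le> real k * (c * n) + real K * Q"
  proof (intro add_mono mult_left_mono QK)
    have "real (card (nbhd v \<inter> ?W - crowded ?B)) \<le> deg v"
      unfolding deg_def by (intro of_nat_mono card_mono) auto
    also have "deg v \<le> c * n" using v by (simp add: low_deg_def n_def)
    finally show "(\<Sum>u\<in>nbhd v \<inter> ?W - crowded ?B. real k) \<le> real k * (c * n)"
      by (simp add: mult_right_mono mult.commute[of "real k"])
  qed auto
  finally have load1: "(\<Sum>u\<in>nbhd v \<inter> ?W. load ?B u) \<le> real k * (c * n) + real K * Q" .

  have v': "v \<in> V" using v W by auto
  have "n / 2 * x v \<le> \<rho>\<^sup>2 * x v"
    using \<rho>_square_ge x_nonneg[OF v'] by (intro mult_right_mono) (auto simp: n_def)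
  also have "\<dots> = \<rho> * (\<Sum>u\<in>nbhd v. x u)"
    using eigen[OF v'] by (simp add: power2_eq_square)
  \<comment> \<open>The eigenvalue equation is applied a second time only at neighbours of low
    degree; those of high degree cost just \<open>\<rho> * real K\<close>.\<close>
  also have "\<dots> = (\<Sum>u\<in>nbhd v \<inter> ?W. \<rho> * x u) + \<rho> * load ?B v"
    by (simp add: sum_split load_def sum_distrib_left distrib_left)
  also have "(\<Sum>u\<in>nbhd v \<inter> ?W. \<rho> * x u) = (\<Sum>u\<in>nbhd v \<inter> ?W. z u + load ?B u)"
    using eig W by (intro sum.cong) auto
  also have "\<dots> = (\<Sum>u\<in>nbhd v \<inter> ?W. z u) + (\<Sum>u\<in>nbhd v \<inter> ?W. load ?B u)"
    by (rule sum.distrib)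
  also have "\<dots> + \<rho> * load ?B v
      \<le> (\<omega> * n * (4 * real k) + (real k * (c * n) + real K * Q)) + \<rho> * real K"
    using tw2 mult_left_mono[OF sqrtY Fn] load1 \<rho>_nonneg loadK
    by (intro add_mono mult_left_mono) auto
  finally show ?thesis by (simp add: mult_ac)
qed

section \<open>Walks of length 2 and the k vertices with entries close to 1\<close>

lemma eigen_square_le:
  fixes \<eta> :: real
  assumes B: "B \<subseteq> V" and \<eta>: "\<And>v. v \<in> V - B \<Longrightarrow> x v \<le> \<eta>" "0 \<le> \<eta>" and v: "v \<in> V"
  shows "\<rho>\<^sup>2 * x v \<le> (\<Sum>u\<in>nbhd v - crowded B. load B u)
    + real (card B) * (real M * 2 ^ card B) + \<eta> * (D * real (card V))"
proof -
  have "\<rho>\<^sup>2 * x v = (\<Sum>u\<in>nbhd v. \<Sum>w\<in>nbhd u. x w)" using v by (rule eigen_square)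
  \<comment> \<open>Endpoints in \<open>B\<close> make up the load of the middle vertex; each
    endpoint outside \<open>B\<close> has entry at most \<open>\<eta>\<close>.\<close>
  also have "\<dots> \<le> (\<Sum>u\<in>nbhd v. load B u + \<eta> * deg u)"
  proof (rule sum_mono)
    fix u
    have "(\<Sum>w\<in>nbhd u - B. x w) \<le> real (card (nbhd u - B)) * \<eta>"
      using \<eta> nbhd_subset by (intro sum_bounded_above) auto
    also have "\<dots> \<le> deg u * \<eta>"
      unfolding deg_def using \<eta> by (intro mult_right_mono of_nat_mono card_mono) auto
    finally have "(\<Sum>w\<in>nbhd u - B. x w) \<le> \<eta> * deg u" by (simp add: mult.commute)
    then show "(\<Sum>w\<in>nbhd u. x w) \<le> load B u + \<eta> * deg u"
      using sum.Int_Diff[of "nbhd u" x B] by (simp add: load_def)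
  qed
  also have "\<dots> = (\<Sum>u\<in>nbhd v. load B u) + \<eta> * (\<Sum>u\<in>nbhd v. deg u)"
    by (simp add: sum.distrib sum_distrib_left)
  also have "\<dots> \<le> ((\<Sum>u\<in>nbhd v - crowded B. load B u) + real (card B) * (real M * 2 ^ card B))
      + \<eta> * (D * real (card V))"
    using \<eta> sum_deg_nbhd_le load_le_card_set[OF B] nbhd_subset
    by (intro add_mono mult_left_mono sum_not_crowded_le[OF B]) auto
  finally show ?thesis .
qed

text \<open>Here \<open>r\<close> is the unit of relative loss: the quantities in \<open>err\<close>
  and \<open>M\<close> cost at most \<open>r * n\<close> each, and \<open>\<rho>r\<close> loses a
  proportion 3r. The constants 5, 9 and 22 record how these losses accumulate for the entries on
  \<open>X\<close>, for its common neighbourhood and for the entries off \<open>X\<close>.\<close>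

lemma almost_complete_bipartite:
  fixes \<eta> r :: real and K :: nat
  defines "n \<equiv> real (card V)"
  assumes B: "B \<subseteq> V" "card B \<le> K" and \<eta>: "\<And>v. v \<in> V - B \<Longrightarrow> x v \<le> \<eta>" "0 \<le> \<eta>"
    and r: "0 < r" "5 * real k * r < 1"
    and err: "real K * (real M * 2 ^ K) + \<eta> * (D * n) \<le> r * n"
    and M: "real M \<le> r * n"
    and \<rho>r: "real k * n * (1 - 3 * r) \<le> \<rho>\<^sup>2"
  obtains X where "X \<subseteq> V" "card X = k" "\<And>v. v \<in> X \<Longrightarrow> 1 - 5 * real k * r \<le> x v"
    "n * (1 - 9 * (real k)\<^sup>2 * r) \<le> real (card (common_nbhd X))"
    "\<And>v. v \<in> V - X \<Longrightarrow> x v \<le> 22 * (real k)\<^sup>2 * r"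
proof -
  have n0: "0 < n" using card_V_pos by (simp add: n_def)
  have k1: "1 \<le> real k" using k_pos by simp
  have finB: "finite B" using B finite_V finite_subset by blast
  have err': "real (card B) * (real M * 2 ^ card B) + \<eta> * (D * n) \<le> r * n"
  proof -
    have "real (card B) * (real M * 2 ^ card B) \<le> real K * (real M * 2 ^ K)"
      using B by (intro mult_mono power_increasing) auto
    then show ?thesis using err by linarith
  qed
  have sq: "\<rho>\<^sup>2 * x v \<le> (\<Sum>u\<in>nbhd v - crowded B. load B u) + r * n" if "v \<in> V" for v
    using eigen_square_le[OF B(1) \<eta> that] err' by (simp add: n_def)
  \<comment> \<open>Loads are at most k off the crowded vertices. Hence an entry close to 1 forces a
    degree close to n, and a small degree forces a small entry; both readings are used
    below.\<close>
  have sqdeg: "\<rho>\<^sup>2 * x v \<le> real k * deg v + r * n" if "v \<in> V" for v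
  proof -
    have "(\<Sum>u\<in>nbhd v - crowded B. load B u) \<le> real (card (nbhd v - crowded B)) * real k"
      using load_not_crowded nbhd_subset by (intro sum_bounded_above) auto
    also have "\<dots> \<le> deg v * real k"
      unfolding deg_def by (intro mult_right_mono of_nat_mono card_mono) auto
    finally show ?thesis using sq[OF that] by (simp add: mult.commute)
  qed
  \<comment> \<open>Otherwise the expansion at a vertex of entry 1 gives k n (1 - 3r) <= k n (1 -
    5r) + r n, that is, 2k <= 1.\<close>
  have "\<exists>u\<in>V - crowded B. real k * (1 - 5 * r) < load B u"
  proof (rule ccontr)
    assume "\<not> ?thesis"
    then have le: "\<And>u. u \<in> V - crowded B \<Longrightarrow> load B u \<le> real k * (1 - 5 * r)" by force
    obtain v where v: "v \<in> V" "x v = 1" using x_max by blast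
    have r5: "0 \<le> 1 - 5 * r"
    proof -
      have "1 * (5 * r) \<le> real k * (5 * r)" using k1 r by (intro mult_right_mono) auto
      also have "\<dots> = 5 * real k * r" by simp
      finally show ?thesis using r by linarith
    qed
    have "(\<Sum>u\<in>nbhd v - crowded B. load B u) \<le> real (card (nbhd v - crowded B)) * (real k * (1 - 5 * r))"
      using le nbhd_subset by (intro sum_bounded_above) auto
    also have "\<dots> \<le> n * (real k * (1 - 5 * r))"
      unfolding n_def using r5 nbhd_subset finite_V
      by (intro mult_right_mono of_nat_mono card_mono) auto
    finally have "real k * n * (1 - 3 * r) \<le> n * (real k * (1 - 5 * r)) + r * n"
      using sq[OF v(1)] v \<rho>r by simp
    then have "2 * real k * (r * n) \<le> 1 * (r * n)" by (simp add: algebra_simps)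
    moreover have "0 < r * n" using r n0 by simp
    ultimately have "2 * real k \<le> 1" by (simp only: mult_le_cancel_right_pos)
    then show False using k1 by linarith
  qed
  then obtain u where u: "u \<in> V - crowded B" "real k * (1 - 5 * r) < load B u" by blast
  define X where "X = nbhd u \<inter> B"
  have XV: "X \<subseteq> V" using B by (auto simp: X_def)
  have finX: "finite X" by (simp add: X_def)
  have u': "real k - 5 * real k * r < load B u" using u(2) by (simp add: algebra_simps)
  \<comment> \<open>Not being crowded, \<open>u\<close> has at most k neighbours in
    \<open>B\<close>; its load exceeds k - 1 because 5kr < 1, so integrality leaves exactly
    k.\<close>
  have cardX: "card X = k"
  proof -
    have "card X \<le> k" using u by (auto simp: crowded_def X_def)
    moreover have "real k - 1 < real (card X)"
      using u' r load_le_card[of B u] unfolding X_def by linarith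
    ultimately show ?thesis by linarith
  qed
  have xX: "1 - 5 * real k * r \<le> x w" if w: "w \<in> X" for w
  proof -
    have "load B u = x w + (\<Sum>w\<in>X - {w}. x w)"
      using w finX by (simp add: load_def X_def sum.remove)
    \<comment> \<open>The other k - 1 entries are at most 1, so \<open>x w\<close> can fall short of
      1 by no more than the total deficit 5kr of the load.\<close>
    also have "(\<Sum>w\<in>X - {w}. x w) \<le> real (card (X - {w})) * 1"
      using XV x_le_1 by (intro sum_bounded_above) auto
    also have "card (X - {w}) = k - 1" using w finX cardX by simp
    finally show ?thesis using u' k_pos by (simp add: of_nat_diff)
  qed
  have degX: "n * (1 - 9 * real k * r) \<le> deg w" if w: "w \<in> X" for w
  proof -
    have wV: "w \<in> V" using w XV by blast
    have "real k * n * (1 - 3 * r) * (1 - 5 * real k * r) \<le> \<rho>\<^sup>2 * x w"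
      using \<rho>r xX[OF w] r by (intro mult_mono) auto
    also have "\<dots> \<le> real k * deg w + r * n" by (rule sqdeg[OF wV])
    also have "\<dots> \<le> real k * deg w + real k * (r * n)"
      using k1 r n0 by simp
    finally have "real k * (n * ((1 - 3 * r) * (1 - 5 * real k * r) - r)) \<le> real k * deg w"
      by (simp add: algebra_simps)
    then have "n * ((1 - 3 * r) * (1 - 5 * real k * r) - r) \<le> deg w" using k1 by simp
    \<comment> \<open>The losses 3r, 5kr and r add up to at most 9kr because k >= 1; the product of
      the first two only helps.\<close>
    moreover have "1 - 9 * real k * r \<le> (1 - 3 * r) * (1 - 5 * real k * r) - r"
    proof -
      have "r \<le> real k * r" using k1 r by simp
      moreover have "0 \<le> real k * r * r" using r by simp
      ultimately show ?thesis by (simp add: algebra_simps)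
    qed
    ultimately show ?thesis using n0 by (meson less_imp_le mult_left_mono order_trans)
  qed
  define R where "R = common_nbhd X"
  have RV: "R \<subseteq> V" by (auto simp: R_def common_nbhd_def)
  have VR: "real (card (V - R)) \<le> 9 * (real k)\<^sup>2 * r * n"
  proof -
    \<comment> \<open>Union bound over the k vertices of \<open>X\<close>, each missing at most 9krn
      vertices.\<close>
    have "V - R \<subseteq> (\<Union>w\<in>X. V - nbhd w)" by (auto simp: R_def common_nbhd_def nbhd_def)
    then have "card (V - R) \<le> card (\<Union>w\<in>X. V - nbhd w)"
      using finX finite_V by (intro card_mono) auto
    also have "\<dots> \<le> (\<Sum>w\<in>X. card (V - nbhd w))" using finX by (rule card_UN_le)
    finally have "real (card (V - R)) \<le> (\<Sum>w\<in>X. real (card (V - nbhd w)))"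
      by (simp flip: of_nat_sum)
    also have "\<dots> \<le> real (card X) * (9 * real k * r * n)"
    proof (rule sum_bounded_above)
      fix w assume w: "w \<in> X"
      have "card (V - nbhd w) = card V - card (nbhd w)"
        using nbhd_subset by (intro card_Diff_subset) auto
      moreover have "card (nbhd w) \<le> card V" using nbhd_subset finite_V by (intro card_mono) auto
      ultimately have "real (card (V - nbhd w)) = n - deg w" by (simp add: n_def deg_def of_nat_diff)
      then show "real (card (V - nbhd w)) \<le> 9 * real k * r * n"
        using degX[OF w] by (simp add: algebra_simps)
    qed
    finally show ?thesis by (simp add: cardX power2_eq_square mult_ac)
  qed
  have "real (card (V - R)) = n - real (card R)"
    using RV finite_V card_mono[OF finite_V RV]
    by (simp add: n_def card_Diff_subset finite_subset of_nat_diff)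
  then have R: "n * (1 - 9 * (real k)\<^sup>2 * r) \<le> real (card R)"
    using VR by (simp add: algebra_simps)
  have out: "x v \<le> 22 * (real k)\<^sup>2 * r" if v: "v \<in> V - X" for v
  proof -
    \<comment> \<open>A neighbour of \<open>v\<close> inside \<open>R\<close> is adjacent to all k+1
      vertices of \<open>insert v X\<close>, so there are fewer than \<open>M\<close> of them; the
      other neighbours lie in the small set \<open>V - R\<close>.\<close>
    have "nbhd v \<subseteq> common_nbhd (insert v X) \<union> (V - R)"
      by (auto simp: nbhd_def common_nbhd_def R_def)
    then have "card (nbhd v) \<le> card (common_nbhd (insert v X) \<union> (V - R))"
      using finite_V by (intro card_mono) auto
    also have "\<dots> \<le> card (common_nbhd (insert v X)) + card (V - R)" by (rule card_Un_le)
    also have "card (common_nbhd (insert v X)) < M"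
      using few_common[of "insert v X"] v XV finX cardX by (simp add: common_nbhd_def)
    finally have "deg v \<le> real M + real (card (V - R))" unfolding deg_def by linarith
    then have dv: "deg v \<le> r * n + 9 * (real k)\<^sup>2 * r * n" using VR M by linarith
    have "real k * n / 2 * x v \<le> \<rho>\<^sup>2 * x v"
      using \<rho>_large x_nonneg[of v] v by (intro mult_right_mono) (auto simp: n_def)
    also have "\<dots> \<le> real k * deg v + r * n" using sqdeg v by blast
    also have "\<dots> \<le> real k * (r * n + 9 * (real k)\<^sup>2 * r * n) + real k * (r * n)"
      using dv k1 r n0 by (intro add_mono mult_left_mono) auto
    also have "\<dots> = (real k * n / 2) * ((4 + 18 * (real k)\<^sup>2) * r)"
      by (simp add: algebra_simps)
    finally have "x v \<le> (4 + 18 * (real k)\<^sup>2) * r"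
      using mult_le_cancel_left_pos[of "real k * n / 2"] k1 n0 by simp
    also have "\<dots> \<le> (4 * (real k)\<^sup>2 + 18 * (real k)\<^sup>2) * r"
      using k1 r by (intro mult_right_mono) (auto simp: one_le_power)
    finally show ?thesis by simp
  qed
  show ?thesis using that[OF XV cardX xX R[unfolded R_def] out] by blast
qed

end

section \<open>Choice of the degree threshold and of all constants\<close>

lemma (in sparse_graph) low_deg_walks_le:
  fixes c \<omega> :: real
  defines "n \<equiv> real (card V)"
  assumes V: "V \<noteq> {}" and D: "0 < D" and c: "0 \<le> c" and \<omega>: "0 < \<omega>"
    and c_small: "(real M + (real (Suc k))\<^sup>2) * c * D ^ Suc k \<le> \<omega>\<^sup>2 / 2 * (\<omega>\<^sup>2 / (2 * D)) ^ k"
  shows "(\<Sum>v\<in>low_deg c. deg v * (\<Sum>a\<in>nbhd v \<inter> low_deg c. deg a)) \<le> (\<omega> * n)\<^sup>2"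
proof -
  define \<tau> where "\<tau> = \<omega>\<^sup>2 / (2 * D)"
  have \<tau>: "0 < \<tau>" using D \<omega> by (simp add: \<tau>_def)
  have n: "0 < n" using V finite_V by (simp add: n_def card_gt_0_iff)
  have total: "(\<Sum>v\<in>low_deg c. deg v) \<le> D * n"
    using order_trans[OF sum_mono2 sum_deg_le, of "low_deg c"] finite_V low_deg_subset
    by (simp add: n_def)
  \<comment> \<open>The edge-sum bound is used with weight \<open>deg\<close>, cap c n, total D n
    and threshold \<open>\<tau> * n\<close>, so that both resulting terms have order n^2.\<close>
  have "(\<Sum>v\<in>low_deg c. deg v * (\<Sum>a\<in>nbhd v \<inter> low_deg c. deg a))
    \<le> \<tau> * n * (D * n) + (real M + (real (Suc k))\<^sup>2) * (c * n) * (D * n) ^ Suc k / (\<tau> * n) ^ k"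
    using total c n \<tau> by (intro weighted_edge_sum_le low_deg_subset) (auto simp: low_deg_def n_def)
  also have "\<dots> = n\<^sup>2 * (\<tau> * D + (real M + (real (Suc k))\<^sup>2) * c * D ^ Suc k / \<tau> ^ k)"
    using n \<tau> by (simp add: power_mult_distrib power2_eq_square field_simps)
  \<comment> \<open>The choice of \<open>\<tau>\<close> gives the first term exactly one half; the
    second term is linear in \<open>c\<close>, and \<open>c_small\<close> fits it into the other
    half.\<close>
  also have "\<dots> \<le> n\<^sup>2 * (\<omega>\<^sup>2 / 2 + \<omega>\<^sup>2 / 2)"
  proof (intro mult_left_mono add_mono)
    show "\<tau> * D \<le> \<omega>\<^sup>2 / 2" using D by (simp add: \<tau>_def)
    show "(real M + (real (Suc k))\<^sup>2) * c * D ^ Suc k / \<tau> ^ k \<le> \<omega>\<^sup>2 / 2"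
      using c_small \<tau> by (simp add: pos_divide_le_eq \<tau>_def)
  qed simp
  finally show ?thesis by (simp add: power_mult_distrib mult.commute)
qed

text \<open>The constants are fixed in the order \<open>\<eta>\<close>, \<open>\<omega>\<close>,
  \<open>c\<close>, \<open>K\<close>, \<open>n0\<close>, each from earlier ones and from
  \<open>k\<close>, \<open>M\<close>, \<open>D\<close>, \<open>r\<close> only. Quantifying over the
  graph and the eigenvector after \<open>n0\<close> makes the threshold uniform, also for a family
  that varies with the order.\<close>

lemma exists_almost_complete_bipartite:
  fixes k M :: nat and D r :: real
  assumes k: "1 \<le> k" and D: "0 < D" and r: "0 < r" "5 * real k * r < 1"
  shows "\<exists>n0. \<forall>(V :: 'a set) adj x \<rho>. spectral_graph V adj k M D x \<rho> \<and> n0 \<le> card V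
      \<and> real k * real (card V) * (1 - 3 * r) \<le> \<rho>\<^sup>2 \<longrightarrow>
    (\<exists>X\<subseteq>V. card X = k \<and> (\<forall>v\<in>X. 1 - 5 * real k * r \<le> x v)
      \<and> real (card V) * (1 - 9 * (real k)\<^sup>2 * r) \<le> real (card {u\<in>V. \<forall>w\<in>X. adj w u})
      \<and> (\<forall>v\<in>V - X. x v \<le> 22 * (real k)\<^sup>2 * r))"
proof -
  \<comment> \<open>With this value, entries off the high-degree set cost
    \<open>\<eta> * (D * n) = r * n / 2\<close>, half of the permitted error.\<close>
  define \<eta> where "\<eta> = r / (2 * D)"
  define \<omega> where "\<omega> = min (1 / 8) (\<eta> / (32 * real k))"
  define A where "A = (real M + (real (Suc k))\<^sup>2) * D ^ Suc k"
  define c where "c = min (\<eta> / (8 * real k)) (\<omega>\<^sup>2 / 2 * (\<omega>\<^sup>2 / (2 * D)) ^ k / A)"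
  define K where "K = nat \<lceil>D / c\<rceil>"
  define Q where "Q = real M * 2 ^ K"
  \<comment> \<open>Each summand supplies one of the five inequalities collected in
    \<open>n_large\<close>.\<close>
  define n0 where "n0 = nat \<lceil>(real K)\<^sup>2 * Q + real K * Q * (8 / \<eta>) + 64 * (real K)\<^sup>2 * D / \<eta>\<^sup>2
    + 2 * (real K * Q) / r + real M / r\<rceil>"
  have \<eta>: "0 < \<eta>" using D r by (simp add: \<eta>_def)
  have \<omega>: "0 < \<omega>" "\<omega> \<le> 1 / 8" "4 * real k * \<omega> \<le> \<eta> / 8"
    using \<eta> k by (auto simp: \<omega>_def min_def field_simps)
  have A: "0 < A" using D by (simp add: A_def add_nonneg_pos)
  have c: "0 < c" "real k * c \<le> \<eta> / 8"
    using \<eta> k \<omega> D A by (auto simp: c_def min_def field_simps)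
  have "c \<le> \<omega>\<^sup>2 / 2 * (\<omega>\<^sup>2 / (2 * D)) ^ k / A" by (simp add: c_def)
  then have cA: "(real M + (real (Suc k))\<^sup>2) * c * D ^ Suc k \<le> \<omega>\<^sup>2 / 2 * (\<omega>\<^sup>2 / (2 * D)) ^ k"
    using A by (simp only: pos_le_divide_eq) (simp add: A_def mult_ac)
  have Q: "0 \<le> Q" by (simp add: Q_def)
  have goal: "\<exists>X\<subseteq>V. card X = k \<and> (\<forall>v\<in>X. 1 - 5 * real k * r \<le> x v)
      \<and> real (card V) * (1 - 9 * (real k)\<^sup>2 * r) \<le> real (card {u\<in>V. \<forall>w\<in>X. adj w u})
      \<and> (\<forall>v\<in>V - X. x v \<le> 22 * (real k)\<^sup>2 * r)"
    if G: "spectral_graph V adj k M D x \<rho>" and n0: "n0 \<le> card V"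
      and \<rho>: "real k * real (card V) * (1 - 3 * r) \<le> \<rho>\<^sup>2" for V :: "'a set" and adj x \<rho>
  proof -
    interpret spectral_graph V adj k M D x \<rho> by (rule G)
    define n where "n = real (card V)"
    have n: "0 < n" using card_V_pos by (simp add: n_def)
    have Vne: "V \<noteq> {}" using x_max by blast
    have "(real K)\<^sup>2 * Q + real K * Q * (8 / \<eta>) + 64 * (real K)\<^sup>2 * D / \<eta>\<^sup>2
      + 2 * (real K * Q) / r + real M / r \<le> n"
      using n0 unfolding n0_def n_def by linarith
    moreover have "0 \<le> (real K)\<^sup>2 * Q" "0 \<le> real K * Q * (8 / \<eta>)" "0 \<le> 64 * (real K)\<^sup>2 * D / \<eta>\<^sup>2"
      "0 \<le> 2 * (real K * Q) / r" "0 \<le> real M / r"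
      using Q \<eta> D r by auto
    ultimately have "(real K)\<^sup>2 * Q \<le> n" "real K * Q * (8 / \<eta>) \<le> n" "64 * (real K)\<^sup>2 * D / \<eta>\<^sup>2 \<le> n"
      "2 * (real K * Q) / r \<le> n" "real M / r \<le> n"
      by linarith+
    then have n_large: "(real K)\<^sup>2 * Q \<le> n" "real K * Q \<le> \<eta> * n / 8"
      "64 * (real K)\<^sup>2 * D \<le> n * \<eta>\<^sup>2" "2 * (real K * Q) \<le> r * n" "real M \<le> r * n"
      using \<eta> r by (simp_all add: field_simps)
    have walks: "(\<Sum>v\<in>low_deg c. deg v * (\<Sum>a\<in>nbhd v \<inter> low_deg c. deg a)) \<le> (\<omega> * n)\<^sup>2"
      unfolding n_def using Vne D c \<omega> cA by (intro low_deg_walks_le) auto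
    have B: "high_deg c \<subseteq> V" "card (high_deg c) \<le> K"
      using card_high_deg_le[OF Vne c(1)] high_deg_subset by (auto simp: K_def) linarith
    have K\<rho>: "real K * \<rho> \<le> \<eta> * n / 8"
    proof (rule power2_le_imp_le)
      have "(real K * \<rho>)\<^sup>2 \<le> (real K)\<^sup>2 * (D * n)"
        using \<rho>_square_le by (simp add: power_mult_distrib mult_left_mono n_def)
      also have "\<dots> \<le> (\<eta> * n / 8)\<^sup>2"
        using mult_right_mono[OF n_large(3), of n] n
        by (simp add: power2_eq_square field_simps)
      finally show "(real K * \<rho>)\<^sup>2 \<le> (\<eta> * n / 8)\<^sup>2" .
    qed (use \<eta> n in simp)
    have \<omega>c: "4 * real k * \<omega> * n \<le> \<eta> / 8 * n" "real k * c * n \<le> \<eta> / 8 * n"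
      using \<omega>(3) c(2) n by (auto intro: mult_right_mono)
    have small: "x v \<le> \<eta>" if "v \<in> low_deg c" for v
    proof -
      have "n / 2 * x v \<le> 4 * real k * \<omega> * n + real k * c * n + real K * Q + real K * \<rho>"
        using that \<omega> walks B n_large(1) unfolding n_def Q_def by (intro entry_low_deg_le) auto
      \<comment> \<open>Each of the four terms is at most \<open>\<eta> * n / 8\<close>.\<close>
      also have "\<dots> \<le> n / 2 * \<eta>"
        using K\<rho> \<omega>c n_large(2) by (simp add: field_simps)
      finally show ?thesis using n by simp
    qed
    have err: "real K * (real M * 2 ^ K) + \<eta> * (D * real (card V)) \<le> r * real (card V)"
      using n_large(4) D unfolding Q_def n_def by (simp add: \<eta>_def)
    have \<eta>': "\<And>v. v \<in> V - high_deg c \<Longrightarrow> x v \<le> \<eta>" "0 \<le> \<eta>"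
      using small \<eta> by (auto simp: low_deg_def high_deg_def)
    obtain X where "X \<subseteq> V" "card X = k" "\<And>v. v \<in> X \<Longrightarrow> 1 - 5 * real k * r \<le> x v"
      "real (card V) * (1 - 9 * (real k)\<^sup>2 * r) \<le> real (card (common_nbhd X))"
      "\<And>v. v \<in> V - X \<Longrightarrow> x v \<le> 22 * (real k)\<^sup>2 * r"
      using almost_complete_bipartite[OF B \<eta>' r err n_large(5)[unfolded n_def] \<rho>] by blast
    then show ?thesis unfolding common_nbhd_def by (intro exI[of _ X] conjI ballI)
  qed
  then show ?thesis by blast
qed

section \<open>Embedding family members; edge counts, degrees and the adjacency matrix\<close>

lemma contains_of_indep_cover:
  fixes F :: "'b ugraph" and G :: "'a ugraph"
  assumes F: "simple_graph F" and S: "independent_set F S" "covering F S"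
    and G: "simple_graph G" and X: "X \<subseteq> verts G" "card X = card S"
    and large: "card (verts F) \<le> card {u\<in>verts G. \<forall>w\<in>X. {w, u} \<in> edges G}"
  shows "contains G F"
proof -
  define Y where "Y = {u\<in>verts G. \<forall>w\<in>X. {w, u} \<in> edges G}"
  have fin: "finite (verts F)" "finite (verts G)" using F G by (auto simp: simple_graph_def)
  have SV: "S \<subseteq> verts F" using S by (simp add: covering_def)
  have finS: "finite S" "finite X" "finite Y" using SV X fin finite_subset by (auto simp: Y_def)
  have "{u} \<notin> edges G" for u
    using G by (auto simp: simple_graph_def)
  \<comment> \<open>A vertex of \<open>X\<close> lying in \<open>Y\<close> would be joined to
    itself, and a singleton is not an edge.\<close>
  then have XY: "X \<inter> Y = {}" by (force simp: Y_def)
  obtain g where g: "bij_betw g S X"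
    using X finS finite_same_card_bij by metis
  have "card (verts F - S) \<le> card Y"
    using large card_mono[OF fin(1), of "verts F - S"] by (auto simp: Y_def)
  then obtain h where h: "h ` (verts F - S) \<subseteq> Y" "inj_on h (verts F - S)"
    using card_le_inj[of "verts F - S" Y] fin finS by auto
  define f where "f v = (if v \<in> S then g v else h v)" for v
  have fS: "f v \<in> X" if "v \<in> S" for v using that g by (auto simp: f_def bij_betw_def)
  have fR: "f v \<in> Y" if "v \<in> verts F - S" for v using that h by (auto simp: f_def)
  have inj: "inj_on f (verts F)"
  proof (rule inj_onI)
    fix p q assume pq: "p \<in> verts F" "q \<in> verts F" "f p = f q"
    have "p \<in> S \<longleftrightarrow> q \<in> S" using pq fS fR XY by (metis DiffI disjoint_iff)
    then show "p = q"
      using pq g h(2) by (cases "p \<in> S") (auto simp: f_def bij_betw_def dest: inj_onD)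
  qed
  have edge: "f ` e \<in> edges G" if e: "e \<in> edges F" for e
  proof -
    have "card e = 2" "e \<subseteq> verts F" using e F by (auto simp: simple_graph_def)
    \<comment> \<open>Covering gives an end in \<open>S\<close>, independence an end outside. Every
      edge of \<open>F\<close> thus crosses, and it is enough that \<open>X\<close> is completely
      joined to \<open>Y\<close>.\<close>
    moreover have "e \<inter> S \<noteq> {}" "\<not> e \<subseteq> S"
      using e S by (auto simp: covering_def independent_set_def)
    ultimately obtain p q where pq: "e = {p, q}" "p \<in> S" "q \<in> verts F - S"
      by (auto simp: card_2_iff)
    then have "{f p, f q} \<in> edges G" using fS[of p] fR[of q] by (auto simp: Y_def)
    then show ?thesis using pq by simp
  qed
  define H where "H = \<lparr>verts = f ` verts F, edges = (\<lambda>e. f ` e) ` edges F\<rparr>"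
  have "f ` verts F \<subseteq> verts G"
    using fS fR X by (auto simp: Y_def)
  then have "subgraph H G" using edge by (auto simp: subgraph_def H_def)
  moreover have "simple_graph H"
    using F inj unfolding simple_graph_def H_def
    by (auto simp: card_image inj_on_subset)
  moreover have "graph_iso F H"
    unfolding graph_iso_def H_def using inj by (auto simp: bij_betw_def)
  ultimately show ?thesis unfolding contains_def by blast
qed

text \<open>The infimum of the empty set is infinite, so a finite value comes from a nonempty set,
  which contains its infimum by well-ordering.\<close>

lemma indep_cover_num_attained:
  assumes "indep_cover_num F = enat b"
  obtains S where "independent_set F S" "covering F S" "card S = b"
proof -
  let ?A = "(\<lambda>S. enat (card S)) ` {S. independent_set F S \<and> covering F S}"
  have eq: "Inf ?A = enat b" using assms by (simp add: indep_cover_num_def)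
  then have "?A \<noteq> {}" by (metis Inf_empty enat.distinct(1) top_enat_def)
  then have "Inf ?A \<in> ?A" unfolding Inf_enat_def by (auto intro: LeastI)
  then show ?thesis using that eq by auto
qed

text \<open>Ordered adjacent pairs are grouped by the edge they span; each edge arises from at most
  two.\<close>

lemma sum_degree_le:
  assumes G: "simple_graph G"
  shows "(\<Sum>v\<in>verts G. card {u\<in>verts G. {v, u} \<in> edges G}) \<le> 2 * card (edges G)"
proof -
  have fin: "finite (verts G)" using G by (simp add: simple_graph_def)
  have "edges G \<subseteq> Pow (verts G)" using G by (auto simp: simple_graph_def)
  then have finE: "finite (edges G)" using fin finite_subset by blast
  let ?P = "\<lambda>e. {p. e = {fst p, snd p}}"
  have P: "finite (?P e) \<and> card (?P e) \<le> 2" if "e \<in> edges G" for e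
  proof -
    have "card e = 2" using that G by (simp add: simple_graph_def)
    then obtain a b where "e = {a, b}" by (auto simp: card_2_iff)
    then have "?P e \<subseteq> {(a, b), (b, a)}" by (auto simp: doubleton_eq_iff)
    then show ?thesis
      using card_mono[of "{(a, b), (b, a)}" "?P e"] card_insert_le_m1[of 2 "{(b, a)}" "(a, b)"]
      by (auto intro: finite_subset)
  qed
  have "(\<Sum>v\<in>verts G. card {u\<in>verts G. {v, u} \<in> edges G})
      = card (SIGMA v:verts G. {u\<in>verts G. {v, u} \<in> edges G})"
    using fin by (simp add: card_SigmaI)
  also have "\<dots> \<le> card (\<Union>e\<in>edges G. ?P e)"
    using finE P by (intro card_mono) auto
  also have "\<dots> \<le> (\<Sum>e\<in>edges G. card (?P e))" using finE by (rule card_UN_le)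
  also have "\<dots> \<le> (\<Sum>e\<in>edges G. 2)" using P by (intro sum_mono) auto
  finally show ?thesis by simp
qed

text \<open>\<open>Max\<close> bounds its elements only on a finite set. There may be infinitely
  many competing graphs on natural numbers, but their edge counts are at most 2 to the power of the
  order.\<close>

lemma card_edges_le_ex_num:
  fixes G :: "nat ugraph"
  assumes "simple_graph G" "family_free \<F> G"
  shows "card (edges G) \<le> ex_num (card (verts G)) \<F>"
proof -
  let ?A = "{card (edges H) | H :: nat ugraph.
    simple_graph H \<and> card (verts H) = card (verts G) \<and> family_free \<F> H}"
  have "?A \<subseteq> {..2 ^ card (verts G)}"
  proof
    fix m assume "m \<in> ?A"
    then obtain H :: "nat ugraph" where H: "m = card (edges H)" "simple_graph H"
      "card (verts H) = card (verts G)" by blast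
    then have "finite (verts H)" "edges H \<subseteq> Pow (verts H)" by (auto simp: simple_graph_def)
    then have "card (edges H) \<le> card (Pow (verts H))" by (intro card_mono) auto
    then show "m \<in> {..2 ^ card (verts G)}"
      using H \<open>finite (verts H)\<close> by (simp add: card_Pow)
  qed
  then have "finite ?A" using finite_subset by blast
  then show ?thesis unfolding ex_num_def using assms by (intro Max_ge) auto
qed

lemma eigenvector_adjacency_sum:
  assumes V: "verts G = {0..<n}" and x: "eigenvector (adjacency_matrix G) x \<rho>" and v: "v < n"
  shows "\<rho> * x $ v = (\<Sum>u | u \<in> {0..<n} \<and> {v, u} \<in> edges G. x $ u)"
proof -
  have dim: "dim_vec x = n"
    using x V by (auto simp: eigenvector_def adjacency_matrix_def)
  have "\<rho> * x $ v = (adjacency_matrix G *\<^sub>v x) $ v"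
    using x v dim by (simp add: eigenvector_def)
  also have "\<dots> = (\<Sum>u\<in>{0..<n}. (if {v, u} \<in> edges G then 1 else 0) * x $ u)"
    using v V dim by (simp add: adjacency_matrix_def scalar_prod_def)
  also have "\<dots> = (\<Sum>u\<in>{0..<n}. if {v, u} \<in> edges G then x $ u else 0)"
    by (intro sum.cong) auto
  also have "\<dots> = (\<Sum>u | u \<in> {0..<n} \<and> {v, u} \<in> edges G. x $ u)"
    by (simp add: sum.inter_filter[symmetric])
  finally show ?thesis .
qed

text \<open>Squaring \<open>p - q \<le> a\<close> is legitimate when \<open>q \<le> p\<close>;
  otherwise \<open>p\<^sup>2 - 2 * p * q\<close> is already at most 0.\<close>

lemma square_ge_of_ge_diff:
  fixes a p q :: real
  assumes "p - q \<le> a" "0 \<le> p" "0 \<le> q"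
  shows "p\<^sup>2 - 2 * p * q \<le> a\<^sup>2"
proof (cases "q \<le> p")
  case True
  then have "(p - q)\<^sup>2 \<le> a\<^sup>2" using assms by (intro power_mono) auto
  then show ?thesis using zero_le_power2[of q] unfolding power2_diff by linarith
next
  case False
  then have "p * p \<le> p * (2 * q)" using assms by (intro mult_left_mono) auto
  then show ?thesis using zero_le_power2[of a] unfolding power2_eq_square by linarith
qed

section \<open>From the spectral lower bound to the bipartite subgraph, with explicit powers of
  \<epsilon>\<close>

theorem theorem3p1:
  fixes C :: real and \<F> :: "nat \<Rightarrow> nat ugraph set" and b :: nat
  assumes "C \<ge> 1"
    and "\<And>n F. F \<in> \<F> n \<Longrightarrow> simple_graph F"
    and "weak_finite_degenerate \<F>"
    and "\<And>n. family_indep_cover_num (\<F> n) = enat b"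
    and "b \<ge> 2"
    and "\<And>n. real (ex_num n (\<F> n)) \<le> C * real n"
  shows "\<exists>\<epsilon>0>0. \<forall>\<epsilon>. 0 < \<epsilon> \<and> \<epsilon> < \<epsilon>0 \<and> \<epsilon> < (1 / (32 * C * real b)) ^ 40 \<longrightarrow>
    (\<exists>n0. \<forall>n\<ge>n0. \<forall>(G :: nat ugraph) (x :: real vec).
       simple_graph G \<and> verts G = {0..<n} \<and> family_free (\<F> n) G \<and>
       eigenvector (adjacency_matrix G) x (spectral_index G) \<and>
       (\<forall>v<n. x $ v \<ge> 0) \<and> Max (vec_set x) = 1 \<and>
       spectral_index G \<ge> sqrt ((real b - 1) * (real n + 1 - real b)) - sqrt (\<epsilon> * real n) \<longrightarrow>
       (\<exists>(t :: nat) L' R'.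
          real t > (1 - 2 * real b * \<epsilon> powr (1/10)) * real n \<and>
          card L' = b - 1 \<and> card R' = t \<and> finite L' \<and> finite R' \<and> L' \<inter> R' = {} \<and>
          subgraph (complete_bipartite L' R') G \<and>
          (\<forall>v\<in>L'. x $ v \<ge> 1 - \<epsilon> powr (1/10)) \<and>
          (\<forall>v\<in>verts G - L'. x $ v \<le> \<epsilon> powr (1/8))))"
proof (rule exI[of _ 1], intro conjI allI impI)
  \<comment> \<open>The witness 1 suffices for \<open>\<epsilon>0\<close>, because the smallness
    used below comes from the bound by a 40th power.\<close>
  show "(0::real) < 1" by simp
next
  fix \<epsilon> :: real
  assume \<epsilon>: "0 < \<epsilon> \<and> \<epsilon> < 1 \<and> \<epsilon> < (1 / (32 * C * real b)) ^ 40"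
  define k where "k = b - 1"
  have b: "b = Suc k" and k: "1 \<le> k" using assms(5) by (auto simp: k_def)
  have k1: "1 \<le> real k" using k by simp
  \<comment> \<open>The order of the witness is bounded uniformly in \<open>n\<close>, so one
    \<open>M\<close> serves for all families in the sequence.\<close>
  obtain M where M: "\<And>n. \<exists>F\<in>\<F> n. bipartite F
      \<and> indep_cover_num F = family_indep_cover_num (\<F> n) \<and> card (verts F) \<le> M"
    using assms(3) unfolding weak_finite_degenerate_def by blast

  \<comment> \<open>40 is the common denominator of 1/10, 1/8 and 1/2: the corresponding powers of
    \<open>\<epsilon>\<close> become \<open>e ^ 4\<close>, \<open>e ^ 5\<close> and
    \<open>e ^ 20\<close>, the last being the square root \<open>r\<close>.\<close>
  define e where "e = \<epsilon> powr (1 / 40)"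
  define r where "r = e ^ 20"
  have e0: "0 < e" using \<epsilon> by (simp add: e_def)
  have epow: "e ^ m = \<epsilon> powr (real m / 40)" for m
    using \<epsilon> by (simp add: e_def powr_powr flip: powr_realpow)
  have e4: "\<epsilon> powr (1 / 10) = e ^ 4" and e5: "\<epsilon> powr (1 / 8) = e ^ 5" and e40: "e ^ 40 = \<epsilon>"
    using \<epsilon> by (simp_all add: epow)
  have sqrt\<epsilon>: "sqrt \<epsilon> = r"
    using e0 by (simp add: r_def flip: e40) (intro real_sqrt_unique; simp flip: power_mult)
  have "e ^ 40 < (1 / (32 * C * real b)) ^ 40" using \<epsilon> e40 by simp
  then have "e < 1 / (32 * C * real b)"
    by (rule power_less_imp_less_base) (use assms(1) in simp)
  also have "\<dots> \<le> 1 / (32 * real b)"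
    using assms(1,5) by (intro divide_left_mono) auto
  finally have be: "e * real b < 1 / 32" using assms(5) by (simp add: field_simps)
  have ke: "e * real k \<le> 1 / 32" using be e0 by (simp add: b distrib_left)
  have e1: "e \<le> 1 / 32" using ke mult_left_mono[of 1 "real k" e] k1 e0 by linarith
  have r0: "0 < r" using e0 by (simp add: r_def)
  have re: "r \<le> e" using power_decreasing[of 1 20 e] e0 e1 by (simp add: r_def)
  \<comment> \<open>As \<open>r\<close> is \<open>e ^ 20\<close>, powers of \<open>e\<close> are to
    spare: by \<open>ke\<close>, one factor \<open>e\<close> pays for each factor k. The same device
    treats k^2 below.\<close>
  have kr: "5 * real k * r \<le> e ^ 4"
  proof -
    have "5 * real k * r = 5 * (e * real k) * e ^ 19" by (simp add: r_def power_Suc[symmetric] eval_nat_numeral)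
    also have "\<dots> \<le> 1 * e ^ 19" using ke e0 by (intro mult_right_mono) auto
    also have "\<dots> \<le> e ^ 4" using e0 e1 by (simp add: power_decreasing)
    finally show ?thesis .
  qed
  have k2r: "22 * (real k)\<^sup>2 * r \<le> e ^ 5"
  proof -
    have "(e * real k)\<^sup>2 \<le> (1 / 32)\<^sup>2" using ke e0 by (intro power_mono) auto
    then have *: "22 * (e * real k)\<^sup>2 \<le> 1" by (simp add: power2_eq_square)
    have "22 * (real k)\<^sup>2 * r = 22 * (e * real k)\<^sup>2 * e ^ 18"
      by (simp add: r_def power_mult_distrib flip: power_add)
    also have "\<dots> \<le> 1 * e ^ 18" using * e0 by (intro mult_right_mono) auto
    also have "\<dots> \<le> e ^ 5" using e0 e1 by (simp add: power_decreasing)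
    finally show ?thesis .
  qed
  have "e ^ 4 < 1" using e0 e1 by (simp add: power_less_one_iff)
  then have kr1: "5 * real k * r < 1" using kr by linarith
  have k2r': "9 * (real k)\<^sup>2 * r < 2 * real b * e ^ 4"
  proof -
    have "9 * (real k)\<^sup>2 * r \<le> 22 * (real k)\<^sup>2 * r" using r0 by (intro mult_right_mono) auto
    also have "\<dots> \<le> e ^ 5" by (rule k2r)
    also have "\<dots> \<le> 1 * e ^ 4" using e0 e1 by (simp add: power_decreasing)
    also have "\<dots> < 2 * real b * e ^ 4" using e0 assms(5) by (intro mult_strict_right_mono) auto
    finally show ?thesis .
  qed

  \<comment> \<open>The factor 2 turns the bound on the number of edges into one on the degree
    sum.\<close>
  have D: "0 < 2 * C" using assms(1) by simp
  obtain n1 where n1: "\<And>(V :: nat set) adj x \<rho>. spectral_graph V adj k M (2 * C) x \<rho> \<Longrightarrow> n1 \<le> card V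
      \<Longrightarrow> real k * real (card V) * (1 - 3 * r) \<le> \<rho>\<^sup>2 \<Longrightarrow>
    (\<exists>X\<subseteq>V. card X = k \<and> (\<forall>v\<in>X. 1 - 5 * real k * r \<le> x v)
      \<and> real (card V) * (1 - 9 * (real k)\<^sup>2 * r) \<le> real (card {u\<in>V. \<forall>w\<in>X. adj w u})
      \<and> (\<forall>v\<in>V - X. x v \<le> 22 * (real k)\<^sup>2 * r))"
    using exists_almost_complete_bipartite[OF k D r0 kr1, where 'a = nat and M = M] by blast
  \<comment> \<open>\<open>k < n\<close> keeps the radicand nonnegative, and n >= k/r bounds k^2 by
    k r n.\<close>
  define n0 where "n0 = max n1 (max (k + 1) (nat \<lceil>real k / r\<rceil>))"

  show "\<exists>n0. \<forall>n\<ge>n0. \<forall>(G :: nat ugraph) (x :: real vec).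
       simple_graph G \<and> verts G = {0..<n} \<and> family_free (\<F> n) G \<and>
       eigenvector (adjacency_matrix G) x (spectral_index G) \<and>
       (\<forall>v<n. x $ v \<ge> 0) \<and> Max (vec_set x) = 1 \<and>
       spectral_index G \<ge> sqrt ((real b - 1) * (real n + 1 - real b)) - sqrt (\<epsilon> * real n) \<longrightarrow>
       (\<exists>(t :: nat) L' R'.
          real t > (1 - 2 * real b * \<epsilon> powr (1/10)) * real n \<and>
          card L' = b - 1 \<and> card R' = t \<and> finite L' \<and> finite R' \<and> L' \<inter> R' = {} \<and>
          subgraph (complete_bipartite L' R') G \<and>
          (\<forall>v\<in>L'. x $ v \<ge> 1 - \<epsilon> powr (1/10)) \<and>
          (\<forall>v\<in>verts G - L'. x $ v \<le> \<epsilon> powr (1/8)))"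
  proof (rule exI[of _ n0], intro allI impI, elim conjE)
    fix n :: nat and G :: "nat ugraph" and x :: "real vec"
    assume n: "n0 \<le> n" and G: "simple_graph G" and V: "verts G = {0..<n}"
      and free: "family_free (\<F> n) G"
      and eig: "eigenvector (adjacency_matrix G) x (spectral_index G)"
      and x0: "\<forall>v<n. x $ v \<ge> 0" and xmax: "Max (vec_set x) = 1"
      and \<rho>: "spectral_index G \<ge> sqrt ((real b - 1) * (real n + 1 - real b)) - sqrt (\<epsilon> * real n)"
    define \<rho> where "\<rho> = spectral_index G"
    have nk: "n1 \<le> n" "k < n" "real k / r \<le> real n" using n by (auto simp: n0_def)
    then have krn: "real k \<le> r * real n" using r0 by (simp add: field_simps)
    have \<rho>_sq: "real k * real n * (1 - 3 * r) \<le> \<rho>\<^sup>2"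
    proof -
      \<comment> \<open>These are the two square roots of the hypothesis. From p^2 = k n - k^2, the
        losses k^2 <= k r n and 2 p q <= 2 k r n add up to the 3r in the claim.\<close>
      define p where "p = sqrt (real k * (real n - real k))"
      define q where "q = sqrt (\<epsilon> * real n)"
      have p2: "p\<^sup>2 = real k * (real n - real k)" and p0: "0 \<le> p"
        using nk by (auto simp: p_def)
      have q: "q = r * sqrt (real n)" by (simp add: q_def real_sqrt_mult sqrt\<epsilon>)
      have "1 * real n \<le> real k * real n" using k1 by (intro mult_right_mono) auto
      then have "real n - real k \<le> real k * real n" by linarith
      then have "p \<le> sqrt ((real k)\<^sup>2 * real n)"
        unfolding p_def power2_eq_square mult.assoc
        by (intro real_sqrt_le_mono mult_left_mono) auto
      then have "p \<le> real k * sqrt (real n)" by (simp add: real_sqrt_mult)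
      then have "p * q \<le> (real k * sqrt (real n)) * (r * sqrt (real n))"
        unfolding q using r0 by (intro mult_right_mono) auto
      also have "\<dots> = real k * r * real n" by simp
      finally have pq: "p * q \<le> real k * r * real n" .
      have "p - q \<le> \<rho>" using \<rho> by (simp add: p_def q_def \<rho>_def b)
      then have "p\<^sup>2 - 2 * p * q \<le> \<rho>\<^sup>2" using p0 \<epsilon> by (intro square_ge_of_ge_diff) (auto simp: q_def)
      moreover have "real k * real k \<le> real k * (r * real n)" using krn by (intro mult_left_mono) auto
      ultimately show ?thesis using pq p2 by (simp add: algebra_simps)
    qed
    have dimx: "dim_vec x = n" using eig V by (auto simp: eigenvector_def adjacency_matrix_def)
    have fin: "finite (vec_set x)" "vec_set x \<noteq> {}"
      using dimx nk by (auto simp: vec_set_def)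
    have x1: "x $ v \<le> 1" if "v < n" for v
    proof -
      have "x $ v \<in> vec_set x" using that dimx by (auto simp: vec_set_def)
      then show ?thesis using Max_ge[OF fin(1)] xmax by metis
    qed
    have xmax': "\<exists>v\<in>{0..<n}. x $ v = 1"
    proof -
      have "1 \<in> vec_set x" using Max_in[OF fin] xmax by metis
      then show ?thesis using dimx by (auto simp: vec_set_def)
    qed
    have loop: "{v} \<notin> edges G" for v using G by (auto simp: simple_graph_def)
    have few: "card {u\<in>{0..<n}. \<forall>w\<in>X. {w, u} \<in> edges G} < M"
      if X: "X \<subseteq> {0..<n}" "card X = Suc k" for X
    proof (rule ccontr)
      assume "\<not> ?thesis"
      then have large: "M \<le> card {u\<in>verts G. \<forall>w\<in>X. {w, u} \<in> edges G}" using V by simp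
      \<comment> \<open>A member of order at most \<open>M\<close> with minimum independent covering
        of size k+1 would embed: its covering into \<open>X\<close>, the rest into the common
        neighbours.\<close>
      obtain F where F: "F \<in> \<F> n" "indep_cover_num F = enat b" "card (verts F) \<le> M"
        using M[of n] assms(4)[of n] by auto
      obtain S where "independent_set F S" "covering F S" "card S = b"
        using indep_cover_num_attained[OF F(2)] by blast
      then have "contains G F"
        using assms(2)[OF F(1)] G X V b F(3) large by (intro contains_of_indep_cover[of F S G X]) auto
      then show False using free F(1) by (auto simp: family_free_def)
    qed
    have degsum: "(\<Sum>v\<in>{0..<n}. real (card {u\<in>{0..<n}. {v, u} \<in> edges G})) \<le> 2 * C * real n"
    proof -
      have "(\<Sum>v\<in>{0..<n}. real (card {u\<in>{0..<n}. {v, u} \<in> edges G})) \<le> 2 * real (card (edges G))"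
        using of_nat_mono[OF sum_degree_le[OF G], where 'a = real] by (simp add: V)
      also have "\<dots> \<le> 2 * real (ex_num n (\<F> n))"
        using card_edges_le_ex_num[OF G free] V by simp
      also have "\<dots> \<le> 2 * (C * real n)" using assms(6)[of n] by simp
      finally show ?thesis by simp
    qed
    interpret sparse_graph "{0..<n}" "\<lambda>u v. {u, v} \<in> edges G" k M "2 * C"
      using loop few degsum by unfold_locales (auto simp: insert_commute)
    interpret spectral_graph "{0..<n}" "\<lambda>u v. {u, v} \<in> edges G" k M "2 * C" "\<lambda>v. x $ v" \<rho>
    proof
      show "\<rho> * x $ v = (\<Sum>u\<in>nbhd v. x $ u)" if "v \<in> {0..<n}" for v
        using eigenvector_adjacency_sum[OF V eig] that by (simp add: nbhd_def \<rho>_def)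
      have "3 * r \<le> 1 / 2" using re e1 by simp
      then have "real k * real n * (1 / 2) \<le> real k * real n * (1 - 3 * r)"
        by (intro mult_left_mono) auto
      then show "real k * real (card {0..<n}) / 2 \<le> \<rho>\<^sup>2" using \<rho>_sq by simp
    qed (use x0 x1 xmax' k in auto)
    obtain X where X: "X \<subseteq> {0..<n}" "card X = k" "\<forall>v\<in>X. 1 - 5 * real k * r \<le> x $ v"
      "real n * (1 - 9 * (real k)\<^sup>2 * r) \<le> real (card (common_nbhd X))"
      "\<forall>v\<in>{0..<n} - X. x $ v \<le> 22 * (real k)\<^sup>2 * r"
      using n1[OF spectral_graph_axioms] nk(1) \<rho>_sq unfolding common_nbhd_def by auto
    show "\<exists>(t :: nat) L' R'.
          real t > (1 - 2 * real b * \<epsilon> powr (1/10)) * real n \<and>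
          card L' = b - 1 \<and> card R' = t \<and> finite L' \<and> finite R' \<and> L' \<inter> R' = {} \<and>
          subgraph (complete_bipartite L' R') G \<and>
          (\<forall>v\<in>L'. x $ v \<ge> 1 - \<epsilon> powr (1/10)) \<and>
          (\<forall>v\<in>verts G - L'. x $ v \<le> \<epsilon> powr (1/8))"
    proof (intro exI conjI)
      \<comment> \<open>The witnesses for \<open>L'\<close> and \<open>R'\<close> are
        \<open>X\<close> and its full common neighbourhood.\<close>
      have "(1 - 2 * real b * e ^ 4) * real n < (1 - 9 * (real k)\<^sup>2 * r) * real n"
        using k2r' nk by (intro mult_strict_right_mono) auto
      then show "(1 - 2 * real b * \<epsilon> powr (1/10)) * real n < real (card (common_nbhd X))"
        using X(4) by (simp add: e4 mult.commute)
      show "card X = b - 1" using X(2) by (simp add: b)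
      show "finite X" using X(1) finite_subset by blast
      show "X \<inter> common_nbhd X = {}" using loop by (force simp: common_nbhd_def)
      show "subgraph (complete_bipartite X (common_nbhd X)) G"
        using X(1) V by (auto simp: subgraph_def complete_bipartite_def common_nbhd_def)
      show "\<forall>v\<in>X. 1 - \<epsilon> powr (1/10) \<le> x $ v" using X(3) kr by (force simp: e4)
      show "\<forall>v\<in>verts G - X. x $ v \<le> \<epsilon> powr (1/8)" using X(5) k2r V by (force simp: e5)
    qed auto
  qed
qed

end
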